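(* Let $N\in\mathbb{N}$ and assume that for all $x\in E_X$ $$\sup_{0\le\tau\le N}\ \sup_{y\in E_Y}\mathbb{E}_{xy}\Big[\sum_{k=0}^{\tau-1}c^+(X_k)+g^+(X_\tau)\Big]<\infty .$$ Then the following holds. a) For $n=1,\dots,N$ and $(x,\mu,s)\in E_X\times\mathbb{P}(E_Y)\times\mathbb{R}$, the functions $V_n$ are given by $V_0(x,\mu,s)=U(g(x)+s)$ and $$V_n(x,\mu,s)=\max\Big\{U\big(g(x)+s\big),\ \int_{E_X}V_{n-1}\big(x',\Phi(x,x',\mu),s+c(x)\big)\,Q^X(dx'|x,\mu)\Big\}.\qquad( * )$$ The value function $J_N$ is given by $J_N(x)=V_N(x,Q_0,0)$. b) For every $n=1,\dots,N$ and $(x,\mu,s)\in E_X\times\mathbb{P}(E_Y)\times\mathbb{R}$ let $f_n^*(x,\mu,s)=1$ if the maximum in $( * )$ is attained at $U(g(x)+s)$ (and $f_n^*(x,\mu,s)=0$ otherwise), and define $(g_0^*,\dots,g_{N-1}^* )$ by $$g_n^*(h_n):=f_{N-n}^*\Big(x_n,\mu_n(\cdot|h_n),\sum_{k=0}^{n-1}c(x_k)\Big),\qquad h_n=(x_0,\dots,x_n),\ n=0,\dots,N-1.$$ Then $\tau^*:=\inf\{n\in\{0,\dots,N-1\}: g_n^*(h_n)=1\}\wedge N$ (evaluated along $h_n=(X_0,\dots,X_n)$, with $\inf\emptyset=\infty$) is an optimal stopping time, i.e. it attains the supremum defining $J_N(x)$.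
   Context: Setting. $E_X,E_Y$ are Borel spaces; $\lambda$ and $\nu$ are $\sigma$-finite measures on $E_X$ and $E_Y$. $(X_n,Y_n)_{n\in\mathbb{N}_0}$ is a Markov process on $E_X\times E_Y$ with transition kernel $Q(B|x,y)=\int_B q(x',y'|x,y)\,\lambda(dx')\,\nu(dy')$, where $q$ is a measurable density. Only $X_n$ is observable. Put $q^X(x'|x,y):=\int_{E_Y}q(x',y'|x,y)\,\nu(dy')$. $\mathbb{P}(E_Y)$ is the set of probability measures on $E_Y$. $Q_0\in\mathbb{P}(E_Y)$ is the known initial distribution of $Y_0$. $\mathbb{P}_{xy}$ (expectation $\mathbb{E}_{xy}$) is the law of the process given $X_0=x,Y_0=y$, and $\mathbb{P}_x:=\int\mathbb{P}_{xy}\,Q_0(dy)$ (expectation $\mathbb{E}_x$). $c:E_X\to\mathbb{R}$ and $g:E_X\to\mathbb{R}$ are measurable, $U:\mathbb{R}\to\mathbb{R}$ is strictly increasing and concave. Stopping times are taken with respect to $\mathcal{F}_n=\sigma(X_0,\dots,X_n)$. Expectations of $U(\cdot)$ take values in $[-\infty,\infty)$. Write $a^+=\max\{a,0\}$; empty sums are $0$. Value functions: $$J_N(x):=\sup_{0\le\tau\le N}\mathbb{E}_x\Big[U\Big(\sum_{k=0}^{\tau-1}c(X_k)+g(X_\tau)\Big)\Big],$$ $$V_n(x,\mu,s):=\sup_{0\le\tau\le n}\int_{E_Y}\mathbb{E}_{xy}\Big[U\Big(\sum_{k=0}^{\tau-1}c(X_k)+s+g(X_\tau)\Big)\Big]\mu(dy),\quad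 n=1,\dots,N,$$ for $(x,\mu,s)\in E_X\times\mathbb{P}(E_Y)\times\mathbb{R}$, the suprema being over stopping times; for $n=0$ the same formula (with $\tau=0$) defines $V_0$. Updating operator $\Phi:E_X\times E_X\times\mathbb{P}(E_Y)\to\mathbb{P}(E_Y)$: $$\Phi(x,x',\mu)(B):=\frac{\int_B\int_{E_Y}q(x',y'|x,y)\,\mu(dy)\,\nu(dy')}{\int_{E_Y}q^X(x'|x,y)\,\mu(dy)},\quad B\in\mathcal{B}(E_Y),$$ and $\Phi(x,x',\mu)$ is a fixed arbitrary probability measure if the denominator is not in $(0,\infty)$. Filter: $\mu_0(\cdot|h_0):=Q_0$ and $\mu_{n+1}(\cdot|h_n,x'):=\Phi(x_n,x',\mu_n(\cdot|h_n))$ for $h_n=(x_0,\dots,x_n)\in E_X^{n+1}$. $Q^X(B|x,\mu):=\int_B\int_{E_Y}q^X(x'|x,y)\,\mu(dy)\,\lambda(dx')$ for measurable $B\subset E_X$. *)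

theory Defs
  imports "HOL-Probability.Probability"
begin

text \<open>
  Expectation of an extended-real-valued function as the difference of the integrals of its
  positive and negative parts (note that \<open>e2ennreal\<close> maps negative numbers to \<open>0\<close>).  Unlike
  the Bochner integral it takes the value \<open>-\<infinity>\<close> where appropriate. The indeterminate case
  \<open>\<infinity> - \<infinity>\<close>, which in \<^typ>\<open>ereal\<close> evaluates to \<open>\<infinity>\<close>, does not arise when the positive part
  has a finite integral.
\<close>

definition ext_integral :: "'a measure \<Rightarrow> ('a \<Rightarrow> ereal) \<Rightarrow> ereal" where
  "ext_integral M f =
     enn2ereal (\<integral>\<^sup>+ x. e2ennreal (f x) \<partial>M) - enn2ereal (\<integral>\<^sup>+ x. e2ennreal (- f x) \<partial>M)"

text \<open>
  The data: \<open>q\<close> of the text is \<open>dens x' y' x y\<close>, the density at \<open>(x', y')\<close> of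
  the transition out of \<open>(x, y)\<close>; \<open>dflt\<close> is the arbitrary probability measure used by the
  updating operator when its denominator is not in \<open>(0, \<infinity>)\<close>.
\<close>

record ('x, 'y) stopping_model =
  spaceX :: "'x set"
  spaceY :: "'y set"
  refX :: "'x measure"
  refY :: "'y measure"
  dens :: "'x \<Rightarrow> 'y \<Rightarrow> 'x \<Rightarrow> 'y \<Rightarrow> ennreal"
  init :: "'y measure"
  cost :: "'x \<Rightarrow> real"
  gain :: "'x \<Rightarrow> real"
  util :: "real \<Rightarrow> real"
  dflt :: "'y measure"

definition BX :: "('x::polish_space, 'y) stopping_model \<Rightarrow> 'x measure" where
  "BX M = restrict_space borel (spaceX M)"

definition BY :: "('x, 'y::polish_space) stopping_model \<Rightarrow> 'y measure" where
  "BY M = restrict_space borel (spaceY M)"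

definition trans_kernel ::
    "('x, 'y) stopping_model \<Rightarrow> 'x \<times> 'y \<Rightarrow> ('x \<times> 'y) measure" where
  "trans_kernel M z =
     density (refX M \<Otimes>\<^sub>M refY M) (\<lambda>(x', y'). dens M x' y' (fst z) (snd z))"

text \<open>A Borel space is a Borel subset of a Polish space, with the trace of the Borel sets.\<close>

locale stopping_problem =
  fixes M :: "('x::polish_space, 'y::polish_space) stopping_model"
  assumes spaceX_borel: "spaceX M \<in> sets borel"
    and spaceY_borel: "spaceY M \<in> sets borel"
    and sets_refX: "sets (refX M) = sets (BX M)"
    and sets_refY: "sets (refY M) = sets (BY M)"
    and sigma_finite_refX: "sigma_finite_measure (refX M)"
    and sigma_finite_refY: "sigma_finite_measure (refY M)"
    and dens_measurable: "(\<lambda>((x', y'), (x, y)). dens M x' y' x y)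
          \<in> borel_measurable ((BX M \<Otimes>\<^sub>M BY M) \<Otimes>\<^sub>M (BX M \<Otimes>\<^sub>M BY M))"
    and trans_kernel_prob: "\<And>z. z \<in> spaceX M \<times> spaceY M \<Longrightarrow> prob_space (trans_kernel M z)"
    and init_prob: "init M \<in> space (prob_algebra (BY M))"
    and cost_measurable: "cost M \<in> borel_measurable (BX M)"
    and gain_measurable: "gain M \<in> borel_measurable (BX M)"
    and util_strict_mono: "strict_mono (util M)"
    and util_concave: "concave_on UNIV (util M)"
    and dflt_prob: "dflt M \<in> space (prob_algebra (BY M))"

text \<open>
  The process \<open>(X\<^sub>n, Y\<^sub>n)\<close> is realised as the coordinate process on the space of all paths in
  \<open>E\<^sub>X \<times> E\<^sub>Y\<close>.
\<close>

definition path_space ::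
    "('x::polish_space, 'y::polish_space) stopping_model \<Rightarrow> (nat \<Rightarrow> 'x \<times> 'y) measure" where
  "path_space M = PiM UNIV (\<lambda>_. BX M \<Otimes>\<^sub>M BY M)"

text \<open>
  Conditional law of the state at time \<open>n\<close> given the states at times \<open>0, \<dots>, n - 1\<close>, when the
  process starts in \<open>z\<close>.
\<close>

definition step_kernel ::
    "('x::polish_space, 'y::polish_space) stopping_model \<Rightarrow> 'x \<times> 'y \<Rightarrow>
     nat \<Rightarrow> (nat \<Rightarrow> 'x \<times> 'y) \<Rightarrow> ('x \<times> 'y) measure" where
  "step_kernel M z n \<omega> =
     (case n of 0 \<Rightarrow> return (BX M \<Otimes>\<^sub>M BY M) z | Suc m \<Rightarrow> trans_kernel M (\<omega> m))"

text \<open>\<open>\<P>\<^sub>x\<^sub>y\<close>: the measure on paths given by the Ionescu-Tulcea theorem.\<close>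

definition law ::
    "('x::polish_space, 'y::polish_space) stopping_model \<Rightarrow> 'x \<Rightarrow> 'y \<Rightarrow>
     (nat \<Rightarrow> 'x \<times> 'y) measure" where
  "law M x y =
     projective_family.lim UNIV
       (Ionescu_Tulcea.CI (step_kernel M (x, y)) (\<lambda>_. BX M \<Otimes>\<^sub>M BY M))
       (\<lambda>_. BX M \<Otimes>\<^sub>M BY M)"

text \<open>
  For starting points in \<open>E\<^sub>X \<times> E\<^sub>Y\<close> the Ionescu-Tulcea theorem applies, so that \<open>law\<close> is indeed
  the measure it provides.
\<close>

lemma (in stopping_problem) Ionescu_Tulcea_step_kernel:
  assumes "x \<in> spaceX M" "y \<in> spaceY M"
  shows "Ionescu_Tulcea (step_kernel M (x, y)) (\<lambda>_. BX M \<Otimes>\<^sub>M BY M)"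
proof -
  let ?B = "BX M \<Otimes>\<^sub>M BY M"
  have sp: "space ?B = spaceX M \<times> spaceY M"
    by (simp add: space_pair_measure BX_def BY_def space_restrict_space)
  have sR: "sets (refX M \<Otimes>\<^sub>M refY M) = sets ?B"
    by (intro sets_pair_measure_cong sets_refX sets_refY)
  interpret X: sigma_finite_measure "refX M" by (rule sigma_finite_refX)
  interpret Y: sigma_finite_measure "refY M" by (rule sigma_finite_refY)
  interpret XY: pair_sigma_finite "refX M" "refY M" ..
  note [measurable] = dens_measurable
  have d: "(\<lambda>(z, z'). dens M (fst z') (snd z') (fst z) (snd z)) \<in> borel_measurable (?B \<Otimes>\<^sub>M ?B)"
  proof -
    have "(\<lambda>p. (\<lambda>((x', y'), (x, y)). dens M x' y' x y) (snd p, fst p))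
        \<in> borel_measurable (?B \<Otimes>\<^sub>M ?B)"
      by measurable
    then show ?thesis by (simp add: case_prod_unfold)
  qed
  have tk: "trans_kernel M \<in> ?B \<rightarrow>\<^sub>M subprob_algebra ?B"
  proof (rule measurable_subprob_algebra)
    fix z assume "z \<in> space ?B"
    then show "subprob_space (trans_kernel M z)"
      by (intro prob_space_imp_subprob_space trans_kernel_prob) (simp add: sp)
    show "sets (trans_kernel M z) = sets ?B"
      by (simp add: trans_kernel_def sR)
  next
    fix A assume A: "A \<in> sets ?B"
    note cong = measurable_cong_sets[OF sets_pair_measure_cong[OF refl sR] refl]
    have 1: "(\<lambda>(z, z'). dens M (fst z') (snd z') (fst z) (snd z) * indicator A z')
        \<in> borel_measurable (?B \<Otimes>\<^sub>M (refX M \<Otimes>\<^sub>M refY M))"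
      using d A unfolding cong by measurable
    have "(\<lambda>z. \<integral>\<^sup>+ z'. dens M (fst z') (snd z') (fst z) (snd z) * indicator A z'
              \<partial>(refX M \<Otimes>\<^sub>M refY M)) \<in> borel_measurable ?B"
      by (rule XY.borel_measurable_nn_integral[OF 1])
    moreover have "emeasure (trans_kernel M z) A =
        (\<integral>\<^sup>+ z'. dens M (fst z') (snd z') (fst z) (snd z) * indicator A z' \<partial>(refX M \<Otimes>\<^sub>M refY M))"
      if "z \<in> space ?B" for z
    proof -
      have "(\<lambda>z'. dens M (fst z') (snd z') (fst z) (snd z))
          \<in> borel_measurable (refX M \<Otimes>\<^sub>M refY M)"
        using measurable_Pair2[OF d that] measurable_cong_sets[OF sR refl] by auto
      then show ?thesis
        using A by (simp add: trans_kernel_def case_prod_unfold emeasure_density sR)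
    qed
    ultimately show "(\<lambda>z. emeasure (trans_kernel M z) A) \<in> borel_measurable ?B"
      by (simp cong: measurable_cong)
  qed
  have xy: "(x, y) \<in> space ?B" using assms by (simp add: sp)
  show ?thesis
  proof (rule Ionescu_Tulcea.intro)
    fix n
    show "step_kernel M (x, y) n \<in> PiM {0..<n} (\<lambda>_. ?B) \<rightarrow>\<^sub>M subprob_algebra ?B"
    proof (cases n)
      case 0
      then show ?thesis
        using xy unfolding step_kernel_def
        by (simp add: space_subprob_algebra prob_space_return prob_space_imp_subprob_space)
    next
      case (Suc m)
      have "(\<lambda>\<omega>. \<omega> m) \<in> PiM {0..<n} (\<lambda>_. ?B) \<rightarrow>\<^sub>M ?B"
        using Suc by (intro measurable_component_singleton) auto
      from measurable_compose[OF this tk] show ?thesis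
        unfolding step_kernel_def Suc by simp
    qed
  next
    fix n :: nat and \<omega>
    assume "\<omega> \<in> space (PiM {0..<n} (\<lambda>_. ?B))"
    then have "\<omega> m \<in> spaceX M \<times> spaceY M" if "m < n" for m
      using that PiE_mem[of \<omega> "{0..<n}" "\<lambda>_. spaceX M \<times> spaceY M" m] unfolding space_PiM sp by simp
    then show "prob_space (step_kernel M (x, y) n \<omega>)"
      using xy by (cases n) (auto simp: step_kernel_def prob_space_return intro!: trans_kernel_prob)
  qed
qed

definition law_init ::
    "('x::polish_space, 'y::polish_space) stopping_model \<Rightarrow> 'x \<Rightarrow> (nat \<Rightarrow> 'x \<times> 'y) measure" where
  "law_init M x = init M \<bind> (\<lambda>y. law M x y)"

definition obs_filtration ::
    "('x::polish_space, 'y::polish_space) stopping_model \<Rightarrow> nat \<Rightarrow> (nat \<Rightarrow> 'x \<times> 'y) measure" where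
  "obs_filtration M n = sigma (space (path_space M))
     {(\<lambda>\<omega>. fst (\<omega> k)) -` A \<inter> space (path_space M) | k A. k \<le> n \<and> A \<in> sets (BX M)}"

definition stopping_times ::
    "('x::polish_space, 'y::polish_space) stopping_model \<Rightarrow> nat \<Rightarrow> ((nat \<Rightarrow> 'x \<times> 'y) \<Rightarrow> nat) set" where
  "stopping_times M n =
     {\<tau>. stopping_time (obs_filtration M) \<tau> \<and> (\<forall>\<omega>\<in>space (path_space M). \<tau> \<omega> \<le> n)}"

definition utility ::
    "('x, 'y) stopping_model \<Rightarrow> real \<Rightarrow> ((nat \<Rightarrow> 'x \<times> 'y) \<Rightarrow> nat) \<Rightarrow> (nat \<Rightarrow> 'x \<times> 'y) \<Rightarrow> real" where
  "utility M s \<tau> \<omega> =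
     util M ((\<Sum>k<\<tau> \<omega>. cost M (fst (\<omega> k))) + s + gain M (fst (\<omega> (\<tau> \<omega>))))"

definition objective ::
    "('x::polish_space, 'y::polish_space) stopping_model \<Rightarrow> 'x \<Rightarrow>
     ((nat \<Rightarrow> 'x \<times> 'y) \<Rightarrow> nat) \<Rightarrow> ereal" where
  "objective M x \<tau> = ext_integral (law_init M x) (\<lambda>\<omega>. ereal (utility M 0 \<tau> \<omega>))"

definition J :: "('x::polish_space, 'y::polish_space) stopping_model \<Rightarrow> nat \<Rightarrow> 'x \<Rightarrow> ereal" where
  "J M N x = (SUP \<tau>\<in>stopping_times M N. objective M x \<tau>)"

definition V ::
    "('x::polish_space, 'y::polish_space) stopping_model \<Rightarrow> nat \<Rightarrow> 'x \<Rightarrow> 'y measure \<Rightarrow> real \<Rightarrow> ereal" where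
  "V M n x \<mu> s = (SUP \<tau>\<in>stopping_times M n.
     ext_integral \<mu> (\<lambda>y. ext_integral (law M x y) (\<lambda>\<omega>. ereal (utility M s \<tau> \<omega>))))"

definition dens_X :: "('x, 'y) stopping_model \<Rightarrow> 'x \<Rightarrow> 'x \<Rightarrow> 'y \<Rightarrow> ennreal" where
  "dens_X M x' x y = (\<integral>\<^sup>+ y'. dens M x' y' x y \<partial>refY M)"

definition kernel_X :: "('x, 'y) stopping_model \<Rightarrow> 'x \<Rightarrow> 'y measure \<Rightarrow> 'x measure" where
  "kernel_X M x \<mu> = density (refX M) (\<lambda>x'. \<integral>\<^sup>+ y. dens_X M x' x y \<partial>\<mu>)"

definition update :: "('x, 'y) stopping_model \<Rightarrow> 'x \<Rightarrow> 'x \<Rightarrow> 'y measure \<Rightarrow> 'y measure" where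
  "update M x x' \<mu> =
     (let d = (\<integral>\<^sup>+ y. dens_X M x' x y \<partial>\<mu>) in
      if 0 < d \<and> d < \<infinity>
      then scale_measure (1 / d) (density (refY M) (\<lambda>y'. \<integral>\<^sup>+ y. dens M x' y' x y \<partial>\<mu>))
      else dflt M)"

text \<open>Only \<open>h 0, \<dots>, h n\<close> enter \<open>filter_dist M n h\<close>, and likewise for \<open>g_star\<close> below.\<close>

primrec filter_dist :: "('x, 'y) stopping_model \<Rightarrow> nat \<Rightarrow> (nat \<Rightarrow> 'x) \<Rightarrow> 'y measure" where
  "filter_dist M 0 h = init M"
| "filter_dist M (Suc n) h = update M (h n) (h (Suc n)) (filter_dist M n h)"

definition continuation ::
    "('x::polish_space, 'y::polish_space) stopping_model \<Rightarrow> nat \<Rightarrow> 'x \<Rightarrow> 'y measure \<Rightarrow> real \<Rightarrow> ereal" where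
  "continuation M n x \<mu> s =
     ext_integral (kernel_X M x \<mu>) (\<lambda>x'. V M (n - 1) x' (update M x x' \<mu>) (s + cost M x))"

definition f_star ::
    "('x::polish_space, 'y::polish_space) stopping_model \<Rightarrow> nat \<Rightarrow> 'x \<Rightarrow> 'y measure \<Rightarrow> real \<Rightarrow> nat" where
  "f_star M n x \<mu> s =
     (if max (ereal (util M (gain M x + s))) (continuation M n x \<mu> s) = ereal (util M (gain M x + s))
      then 1 else 0)"

definition g_star ::
    "('x::polish_space, 'y::polish_space) stopping_model \<Rightarrow> nat \<Rightarrow> nat \<Rightarrow> (nat \<Rightarrow> 'x) \<Rightarrow> nat" where
  "g_star M N n h = f_star M (N - n) (h n) (filter_dist M n h) (\<Sum>k<n. cost M (h k))"

definition tau_star ::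
    "('x::polish_space, 'y::polish_space) stopping_model \<Rightarrow> nat \<Rightarrow> (nat \<Rightarrow> 'x \<times> 'y) \<Rightarrow> nat" where
  "tau_star M N \<omega> = Min ({n. n < N \<and> g_star M N n (\<lambda>k. fst (\<omega> k)) = 1} \<union> {N})"

end

theory Submission
  imports Defs
begin

text \<open>
  Let \<open>\<Phi>\<close> be the updating operator \<open>update\<close>, \<open>Q\<^sup>X\<close> the kernel \<open>kernel_X\<close>, and call the law of the hidden
  state given the observations the belief. The theorem holds because the observation, the belief
  and the accumulated cost together carry everything that a stopping rule can use, so that
  conditioning on the first transition gives a recursion in these three quantities.

  Fix an observation \<open>x\<close>, a belief \<open>\<mu>\<close> and an accumulated cost \<open>s\<close>. Whether a stopping time of the
  observed process stops at time \<open>0\<close> is decided by \<open>x\<close> alone. If it stops, its value is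
  \<open>U (g x + s)\<close>. If it continues, then what is left of it after one step is again a stopping time,
  with a horizon shorter by one, and it does not depend on the hidden state \<open>y\<close>
  (\<open>residual_stopping_time\<close>). The Markov property (\<open>nn_integral_path_law\<close>) and Bayes' formula
  (\<open>filter_disintegration\<close>) then express its value as the \<open>Q\<^sup>X\<close>-integral, over the next observation
  \<open>x'\<close>, of the value of the residual stopping time at \<open>(x', \<Phi> x x' \<mu>, s + c x)\<close>; this is
  \<open>policy_value_continue\<close>. Taking suprema bounds \<open>V\<^sub>n\<^sub>+\<^sub>1\<close> from above by the right-hand side of the
  recursion (\<open>V_Suc_le\<close>).

  For the opposite inequality one stopping time is needed that is optimal for the remaining problem
  simultaneously for all \<open>x'\<close>. It is written down explicitly: \<open>stop_rule\<close> stops as soon as stopping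
  attains the maximum in the recursion, where the initial belief may be any measurable function of
  the first observation. An induction on the horizon shows at once that the value functions are
  measurable, so that the rule is a stopping time, and that it attains the supremum for every first
  observation (\<open>stop_rule_optimal\<close>). The stopping time \<open>\<tau>\<^sup>*\<close> is the instance with constant initial
  belief.

  The utility may have expectation \<open>-\<infinity>\<close>, but its positive part is integrable uniformly in the
  hidden state: the positive parts of costs and gain have uniformly bounded means by assumption, and an
  increasing concave function is bounded above by an affine function of the positive part of its
  argument (\<open>pos_mean_utility_bounded\<close>). Every expectation is therefore a
  difference of two nonnegative integrals of which the first is finite. The theorems for
  nonnegative integrals apply to each of the two, and \<open>ext_integral_diff\<close> recombines them.
\<close>

section \<open>Expectations in the extended reals\<close>

lemma ext_integral_mono:
  assumes "\<And>x. x \<in> space N \<Longrightarrow> f x \<le> g x"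
  shows "ext_integral N f \<le> ext_integral N g"
  unfolding ext_integral_def
  by (intro ereal_minus_mono)
     (auto intro!: nn_integral_mono e2ennreal_mono assms simp: less_eq_ennreal.rep_eq[symmetric])

lemma ext_integral_cong:
  assumes "\<And>x. x \<in> space N \<Longrightarrow> f x = g x"
  shows "ext_integral N f = ext_integral N g"
  unfolding ext_integral_def using assms by (simp cong: nn_integral_cong)

text \<open>
  This is what makes iterated expectations with values in \<open>[-\<infinity>, \<infinity>)\<close> work: if \<open>a\<close> and \<open>b\<close> are the
  positive and negative parts of \<open>p - m\<close>, then \<open>a + m = p + b\<close> almost everywhere, this identity can
  be integrated, and the finite terms can be moved across. Both sides are \<open>-\<infinity>\<close> when the integral of
  \<open>m\<close> is infinite.
\<close>

lemma ext_integral_diff: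
  assumes [measurable]: "p \<in> borel_measurable N" "m \<in> borel_measurable N"
    and fin: "(\<integral>\<^sup>+ x. p x \<partial>N) < \<infinity>"
  shows "ext_integral N (\<lambda>x. enn2ereal (p x) - enn2ereal (m x)) =
    enn2ereal (\<integral>\<^sup>+ x. p x \<partial>N) - enn2ereal (\<integral>\<^sup>+ x. m x \<partial>N)"
proof -
  define a where "a x = e2ennreal (enn2ereal (p x) - enn2ereal (m x))" for x
  define b where "b x = e2ennreal (- (enn2ereal (p x) - enn2ereal (m x)))" for x
  have [measurable]: "a \<in> borel_measurable N" "b \<in> borel_measurable N"
    unfolding a_def b_def by measurable
  have "AE x in N. p x \<noteq> \<infinity>"
    using fin by (intro nn_integral_PInf_AE) auto
  then have bal: "AE x in N. a x + m x = p x + b x"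
  proof eventually_elim
    case (elim x)
    then obtain r where r: "p x = ennreal r" "0 \<le> r"
      by (cases "p x") auto
    show ?case
    proof (cases "m x")
      case (real t)
      then show ?thesis
        using r by (cases "t \<le> r")
          (auto simp: a_def b_def ennreal_plus[symmetric] ennreal_neg simp del: ennreal_plus)
    next
      case top
      then show ?thesis using r by (simp add: a_def b_def)
    qed
  qed
  have "(\<integral>\<^sup>+ x. a x \<partial>N) + (\<integral>\<^sup>+ x. m x \<partial>N) = (\<integral>\<^sup>+ x. a x + m x \<partial>N)"
    by (simp add: nn_integral_add)
  also have "\<dots> = (\<integral>\<^sup>+ x. p x + b x \<partial>N)"
    using bal by (rule nn_integral_cong_AE)
  also have "\<dots> = (\<integral>\<^sup>+ x. p x \<partial>N) + (\<integral>\<^sup>+ x. b x \<partial>N)"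
    by (simp add: nn_integral_add)
  finally have eq: "(\<integral>\<^sup>+ x. a x \<partial>N) + (\<integral>\<^sup>+ x. m x \<partial>N) = (\<integral>\<^sup>+ x. p x \<partial>N) + (\<integral>\<^sup>+ x. b x \<partial>N)" .
  have "a x \<le> p x" for x
  proof -
    have "enn2ereal (p x) - enn2ereal (m x) \<le> enn2ereal (p x) - 0"
      by (intro ereal_minus_mono) auto
    then show ?thesis
      unfolding a_def using e2ennreal_mono[of _ "enn2ereal (p x)"] by simp
  qed
  then have "(\<integral>\<^sup>+ x. a x \<partial>N) \<le> (\<integral>\<^sup>+ x. p x \<partial>N)"
    by (intro nn_integral_mono) auto
  with fin have "(\<integral>\<^sup>+ x. a x \<partial>N) < \<infinity>" by simp
  have alg: "enn2ereal A - enn2ereal B = enn2ereal P - enn2ereal Q"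
    if "A + Q = P + B" "A < \<infinity>" "P < \<infinity>" for A B P Q :: ennreal
    using that
    by (cases A; cases B; cases P; cases Q)
       (auto simp: ennreal_plus[symmetric] simp del: ennreal_plus)
  show ?thesis
    unfolding ext_integral_def a_def[symmetric] b_def[symmetric]
    using alg[OF eq] fin \<open>(\<integral>\<^sup>+ x. a x \<partial>N) < \<infinity>\<close> by simp
qed

lemma measurable_ext_integral:
  assumes f: "(\<lambda>(x, y). f x y) \<in> borel_measurable (A \<Otimes>\<^sub>M B)"
    and K: "K \<in> A \<rightarrow>\<^sub>M subprob_algebra B"
  shows "(\<lambda>x. ext_integral (K x) (f x)) \<in> borel_measurable A"
proof -
  have [measurable]: "(\<lambda>x. \<integral>\<^sup>+ y. e2ennreal (f x y) \<partial>K x) \<in> borel_measurable A"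
    by (rule nn_integral_measurable_subprob_algebra2[OF _ K])
       (use measurable_compose[OF f measurable_e2ennreal] in \<open>simp add: case_prod_unfold\<close>)
  have "(\<lambda>z. - f (fst z) (snd z)) \<in> borel_measurable (A \<Otimes>\<^sub>M B)"
    using f by (intro borel_measurable_uminus_ereal) (simp add: case_prod_unfold)
  then have [measurable]: "(\<lambda>x. \<integral>\<^sup>+ y. e2ennreal (- f x y) \<partial>K x) \<in> borel_measurable A"
    by (intro nn_integral_measurable_subprob_algebra2[OF _ K])
       (use measurable_compose[OF _ measurable_e2ennreal] in \<open>simp add: case_prod_unfold\<close>)
  show ?thesis
    unfolding ext_integral_def by measurable
qed

section \<open>One-step recursion for the path law\<close>

context stopping_problem
begin

abbreviation states :: "('x \<times> 'y) measure" where
  "states \<equiv> BX M \<Otimes>\<^sub>M BY M"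

abbreviation paths :: "(nat \<Rightarrow> 'x \<times> 'y) measure" where
  "paths \<equiv> PiM UNIV (\<lambda>_. states)"

abbreviation path_law :: "'x \<times> 'y \<Rightarrow> (nat \<Rightarrow> 'x \<times> 'y) measure" where
  "path_law z \<equiv> law M (fst z) (snd z)"

lemma space_BX: "space (BX M) = spaceX M" and space_BY: "space (BY M) = spaceY M"
  by (simp_all add: BX_def BY_def space_restrict_space)

lemma space_states: "space states = spaceX M \<times> spaceY M"
  by (simp add: space_pair_measure space_BX space_BY)

lemma Ionescu_Tulcea: "z \<in> space states \<Longrightarrow> Ionescu_Tulcea (step_kernel M z) (\<lambda>_. states)"
  using Ionescu_Tulcea_step_kernel[of "fst z" "snd z"] by (auto simp: space_states)

text \<open>
  The kernel of the Ionescu-Tulcea construction at time \<open>1\<close> is the transition kernel applied to the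
  state at time \<open>0\<close>, so measurability can be read off from there.
\<close>

lemma measurable_trans_kernel: "trans_kernel M \<in> states \<rightarrow>\<^sub>M prob_algebra states"
proof (cases "space states = {}")
  case True
  then show ?thesis by (auto simp: measurable_def)
next
  case False
  then obtain z where z: "z \<in> space states" by auto
  interpret IT: Ionescu_Tulcea "step_kernel M z" "\<lambda>_. states"
    using z by (rule Ionescu_Tulcea)
  have "(\<lambda>w. \<lambda>i\<in>{0..<Suc 0}. w) \<in> states \<rightarrow>\<^sub>M PiM {0..<Suc 0} (\<lambda>_. states)"
    by (intro measurable_restrict) auto
  from measurable_compose[OF this IT.P[of "Suc 0"]]
  have "trans_kernel M \<in> states \<rightarrow>\<^sub>M subprob_algebra states"
    by (simp add: step_kernel_def)
  then show ?thesis
    by (intro measurable_prob_algebraI trans_kernel_prob) (auto simp: space_states)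
qed

lemmas measurable_trans_kernel_subprob = measurable_prob_algebraD[OF measurable_trans_kernel]

lemma sets_path_law [simp]: "z \<in> space states \<Longrightarrow> sets (path_law z) = sets paths"
  and space_path_law [simp]: "z \<in> space states \<Longrightarrow> space (path_law z) = space paths"
proof -
  assume z: "z \<in> space states"
  interpret IT: Ionescu_Tulcea "step_kernel M z" "\<lambda>_. states"
    using z by (rule Ionescu_Tulcea)
  show "sets (path_law z) = sets paths" by (simp add: law_def)
  show "space (path_law z) = space paths" by (simp add: law_def)
qed

lemma path_in_space: "\<omega> \<in> space paths \<Longrightarrow> \<omega> k \<in> space states"
  by (auto simp: space_PiM PiE_iff)

lemma path_in_spaceX: "\<omega> \<in> space paths \<Longrightarrow> fst (\<omega> k) \<in> spaceX M"
  using path_in_space[of \<omega> k] by (auto simp: space_states)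

lemma case_nat_in_paths: "z \<in> space states \<Longrightarrow> \<omega> \<in> space paths \<Longrightarrow> case_nat z \<omega> \<in> space paths"
  by (auto simp: space_PiM PiE_iff split: nat.split)

lemma measurable_freeze_upto:
  "(\<lambda>\<omega> k. \<omega> (min k n)) \<in> PiM {0..<Suc n} (\<lambda>_. states) \<rightarrow>\<^sub>M paths"
  by (intro measurable_PiM_single' measurable_component_singleton) (auto simp: space_PiM PiE_iff)

lemma measurable_overwrite_upto:
  "(\<lambda>(\<xi>, w) k. if k \<le> n then \<xi> k else w) \<in> PiM {0..<Suc n} (\<lambda>_. states) \<Otimes>\<^sub>M states \<rightarrow>\<^sub>M paths"
  unfolding case_prod_unfold
proof (intro measurable_PiM_single')
  fix k
  show "(\<lambda>x. if k \<le> n then fst x k else snd x) \<in> PiM {0..<Suc n} (\<lambda>_. states) \<Otimes>\<^sub>M states \<rightarrow>\<^sub>M states"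
    by (cases "k \<le> n")
       (auto intro!: measurable_compose[OF measurable_fst measurable_component_singleton])
qed (auto simp: space_PiM PiE_iff space_pair_measure)

text \<open>
  The path law is the projective limit of the finite-dimensional laws \<open>C\<close>, which are built by
  appending one state after the other. The integrals of functions of finitely many coordinates are
  therefore computed by this recursion on the last coordinate.
\<close>

lemma nn_integral_path_law_C:
  assumes z: "z \<in> space states" and g: "g \<in> borel_measurable (PiM {0..<n} (\<lambda>_. states))"
  shows "(\<integral>\<^sup>+ \<omega>. g (restrict \<omega> {0..<n}) \<partial>path_law z) =
    (\<integral>\<^sup>+ \<xi>. g \<xi> \<partial>Ionescu_Tulcea.C (step_kernel M z) (\<lambda>_. states) 0 n (\<lambda>_. undefined))"
proof -
  interpret IT: Ionescu_Tulcea "step_kernel M z" "\<lambda>_. states"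
    using z by (rule Ionescu_Tulcea)
  have n: "IT.up_to {0..<n} = n"
    unfolding IT.up_to_def by (rule Least_equality) (auto simp: not_le[symmetric])
  have sC: "sets (IT.C 0 n (\<lambda>_. undefined)) = sets (PiM {0..<n} (\<lambda>_. states))"
    using IT.sets_C[of "\<lambda>_. undefined" 0 n] by (simp add: space_PiM)
  have r: "(\<lambda>\<omega>. restrict \<omega> {0..<n}) \<in> paths \<rightarrow>\<^sub>M PiM {0..<n} (\<lambda>_. states)"
    by (rule measurable_restrict_subset) auto
  have "(\<integral>\<^sup>+ \<omega>. g (restrict \<omega> {0..<n}) \<partial>path_law z) =
      (\<integral>\<^sup>+ \<xi>. g \<xi> \<partial>distr (path_law z) (PiM {0..<n} (\<lambda>_. states)) (\<lambda>\<omega>. restrict \<omega> {0..<n}))"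
    using r z g by (subst nn_integral_distr) (simp_all cong: measurable_cong_sets)
  also have "distr (path_law z) (PiM {0..<n} (\<lambda>_. states)) (\<lambda>\<omega>. restrict \<omega> {0..<n}) =
      IT.CI {0..<n}"
    using IT.distr_lim[of "{0..<n}"] by (simp add: law_def)
  also have "(\<integral>\<^sup>+ \<xi>. g \<xi> \<partial>IT.CI {0..<n}) =
      (\<integral>\<^sup>+ \<xi>. g (restrict \<xi> {0..<n}) \<partial>IT.C 0 n (\<lambda>_. undefined))"
    unfolding IT.CI_def n using sC
    by (subst nn_integral_distr) (auto simp: g measurable_cong_sets[OF sC refl] intro!: measurable_restrict)
  also have "\<dots> = (\<integral>\<^sup>+ \<xi>. g \<xi> \<partial>IT.C 0 n (\<lambda>_. undefined))"
  proof (rule nn_integral_cong)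
    fix \<xi> assume "\<xi> \<in> space (IT.C 0 n (\<lambda>_. undefined))"
    then have "\<xi> \<in> space (PiM {0..<n} (\<lambda>_. states))"
      using sets_eq_imp_space_eq[OF sC] by simp
    then have "restrict \<xi> {0..<n} = \<xi>"
      by (auto simp: space_PiM PiE_restrict)
    then show "g (restrict \<xi> {0..<n}) = g \<xi>" by simp
  qed
  finally show ?thesis .
qed

lemma prob_space_path_law:
  assumes "z \<in> space states" shows "prob_space (path_law z)"
proof -
  interpret IT: Ionescu_Tulcea "step_kernel M z" "\<lambda>_. states"
    using assms by (rule Ionescu_Tulcea)
  have "emeasure (path_law z) (space (path_law z)) = (\<integral>\<^sup>+ \<omega>. 1 \<partial>path_law z)"
    by simp
  also have "\<dots> = (\<integral>\<^sup>+ \<xi>. 1 \<partial>IT.C 0 0 (\<lambda>_. undefined))"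
    using nn_integral_path_law_C[OF assms, of "\<lambda>_. 1" 0] by simp
  also have "\<dots> = 1"
    using prob_space.emeasure_space_1[OF IT.prob_space_C[of "\<lambda>_. undefined" 0 0]]
    by (simp add: space_PiM)
  finally show ?thesis
    by (rule prob_spaceI)
qed

text \<open>
  Functions of the path up to time \<open>n\<close> are represented in the form \<open>f (\<lambda>k. \<omega> (min k n))\<close>, with \<open>f\<close>
  defined on all paths: the path is frozen at time \<open>n\<close>. This keeps every function on one and the
  same space while \<open>n\<close> varies in inductions.
\<close>

lemma nn_integral_path_law_0:
  assumes z: "z \<in> space states" and f[measurable]: "f \<in> borel_measurable paths"
  shows "(\<integral>\<^sup>+ \<omega>. f (\<lambda>k. \<omega> (min k 0)) \<partial>path_law z) = f (\<lambda>_. z)"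
proof -
  interpret IT: Ionescu_Tulcea "step_kernel M z" "\<lambda>_. states"
    using z by (rule Ionescu_Tulcea)
  define g where "g \<xi> = f (\<lambda>k. \<xi> (min k 0))" for \<xi>
  have g[measurable]: "g \<in> borel_measurable (PiM {0..<Suc 0} (\<lambda>_. states))"
    unfolding g_def by (rule measurable_compose[OF measurable_freeze_upto f])
  have u: "(\<lambda>_. undefined) \<in> space (PiM {0..<0::nat} (\<lambda>_. states))"
    by (simp add: space_PiM)
  have "(\<integral>\<^sup>+ \<omega>. f (\<lambda>k. \<omega> (min k 0)) \<partial>path_law z) =
      (\<integral>\<^sup>+ \<omega>. g (restrict \<omega> {0..<Suc 0}) \<partial>path_law z)"
    by (simp add: g_def)
  also have "\<dots> = (\<integral>\<^sup>+ \<xi>. g \<xi> \<partial>IT.C 0 (Suc 0) (\<lambda>_. undefined))"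
    by (rule nn_integral_path_law_C[OF z g])
  also have "\<dots> = (\<integral>\<^sup>+ \<xi>. g \<xi> \<partial>IT.eP 0 (\<lambda>_. undefined))"
    using bind_return[OF IT.measurable_eP u] by simp
  also have "\<dots> = (\<integral>\<^sup>+ w. g ((\<lambda>_. undefined)(0 := w)) \<partial>step_kernel M z 0 (\<lambda>_. undefined))"
    by (rule IT.nn_integral_eP[OF u g])
  also have "\<dots> = (\<integral>\<^sup>+ w. f (\<lambda>_. w) \<partial>return states z)"
    by (simp add: g_def step_kernel_def)
  also have "\<dots> = f (\<lambda>_. z)"
  proof (rule nn_integral_return[OF z])
    have "(\<lambda>w k. w) \<in> states \<rightarrow>\<^sub>M paths"
      by (intro measurable_PiM_single') (auto simp: space_PiM)
    from measurable_compose[OF this f] show "(\<lambda>w. f (\<lambda>_. w)) \<in> borel_measurable states" .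
  qed
  finally show ?thesis .
qed

lemma measurable_step_integral:
  assumes f: "f \<in> borel_measurable paths"
  shows "(\<lambda>\<xi>. \<integral>\<^sup>+ w. f (\<lambda>k. if k \<le> n then \<xi> k else w) \<partial>trans_kernel M (\<xi> n))
    \<in> borel_measurable (PiM {0..<Suc n} (\<lambda>_. states))"
proof (rule nn_integral_measurable_subprob_algebra2)
  show "(\<lambda>(\<xi>, w). f (\<lambda>k. if k \<le> n then \<xi> k else w))
      \<in> borel_measurable (PiM {0..<Suc n} (\<lambda>_. states) \<Otimes>\<^sub>M states)"
    using measurable_compose[OF measurable_overwrite_upto f] by (simp add: case_prod_unfold)
  have "(\<lambda>\<xi>. \<xi> n) \<in> PiM {0..<Suc n} (\<lambda>_. states) \<rightarrow>\<^sub>M states"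
    by (intro measurable_component_singleton) auto
  from measurable_compose[OF this measurable_trans_kernel_subprob]
  show "(\<lambda>\<xi>. trans_kernel M (\<xi> n)) \<in> PiM {0..<Suc n} (\<lambda>_. states) \<rightarrow>\<^sub>M subprob_algebra states" .
qed

lemma nn_integral_path_law_Suc:
  assumes z: "z \<in> space states" and f[measurable]: "f \<in> borel_measurable paths"
  shows "(\<integral>\<^sup>+ \<omega>. f (\<lambda>k. \<omega> (min k (Suc n))) \<partial>path_law z) =
    (\<integral>\<^sup>+ \<omega>. (\<integral>\<^sup>+ w. f (\<lambda>k. if k \<le> n then \<omega> k else w) \<partial>trans_kernel M (\<omega> n)) \<partial>path_law z)"
proof -
  interpret IT: Ionescu_Tulcea "step_kernel M z" "\<lambda>_. states"
    using z by (rule Ionescu_Tulcea)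
  define g where "g \<xi> = f (\<lambda>k. \<xi> (min k (Suc n)))" for \<xi>
  define G where "G \<xi> = (\<integral>\<^sup>+ w. f (\<lambda>k. if k \<le> n then \<xi> k else w) \<partial>trans_kernel M (\<xi> n))" for \<xi>
  have g[measurable]: "g \<in> borel_measurable (PiM {0..<Suc (Suc n)} (\<lambda>_. states))"
    unfolding g_def by (rule measurable_compose[OF measurable_freeze_upto f])
  have G: "G \<in> borel_measurable (PiM {0..<Suc n} (\<lambda>_. states))"
    unfolding G_def by (rule measurable_step_integral[OF f])
  have sC: "space (IT.C 0 (Suc n) (\<lambda>_. undefined)) = space (PiM {0..<Suc n} (\<lambda>_. states))"
    using IT.space_C[of "\<lambda>_. undefined" 0 "Suc n"] by (simp add: space_PiM)
  have "(\<integral>\<^sup>+ \<omega>. f (\<lambda>k. \<omega> (min k (Suc n))) \<partial>path_law z) =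
      (\<integral>\<^sup>+ \<omega>. g (restrict \<omega> {0..<Suc (Suc n)}) \<partial>path_law z)"
    by (simp add: g_def min_less_iff_disj)
  also have "\<dots> = (\<integral>\<^sup>+ \<xi>. g \<xi> \<partial>IT.C 0 (Suc (Suc n)) (\<lambda>_. undefined))"
    by (rule nn_integral_path_law_C[OF z g])
  also have "\<dots> = (\<integral>\<^sup>+ \<xi>. g \<xi> \<partial>(IT.C 0 (Suc n) (\<lambda>_. undefined) \<bind> IT.eP (Suc n)))"
    by simp
  also have "\<dots> = (\<integral>\<^sup>+ \<xi>. \<integral>\<^sup>+ \<zeta>. g \<zeta> \<partial>IT.eP (Suc n) \<xi> \<partial>IT.C 0 (Suc n) (\<lambda>_. undefined))"
  proof (rule nn_integral_bind[OF g])
    have "sets (IT.C 0 (Suc n) (\<lambda>_. undefined)) = sets (PiM {0..<Suc n} (\<lambda>_. states))"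
      using IT.sets_C[of "\<lambda>_. undefined" 0 "Suc n"] by (simp add: space_PiM)
    from measurable_cong_sets[OF this refl]
    show "IT.eP (Suc n) \<in> IT.C 0 (Suc n) (\<lambda>_. undefined) \<rightarrow>\<^sub>M
        subprob_algebra (PiM {0..<Suc (Suc n)} (\<lambda>_. states))"
      using IT.measurable_eP[of "Suc n"] by blast
  qed
  also have "\<dots> = (\<integral>\<^sup>+ \<xi>. G \<xi> \<partial>IT.C 0 (Suc n) (\<lambda>_. undefined))"
  proof (rule nn_integral_cong)
    fix \<xi> assume "\<xi> \<in> space (IT.C 0 (Suc n) (\<lambda>_. undefined))"
    then have "(\<integral>\<^sup>+ \<zeta>. g \<zeta> \<partial>IT.eP (Suc n) \<xi>) =
        (\<integral>\<^sup>+ w. g (\<xi>(Suc n := w)) \<partial>step_kernel M z (Suc n) \<xi>)"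
      unfolding sC by (rule IT.nn_integral_eP[OF _ g])
    also have "\<dots> = G \<xi>"
    proof -
      have "(\<lambda>k. (\<xi>(Suc n := w)) (min k (Suc n))) = (\<lambda>k. if k \<le> n then \<xi> k else w)" for w
        by (auto simp: fun_eq_iff min_def)
      then show ?thesis
        by (simp add: g_def G_def step_kernel_def)
    qed
    finally show "(\<integral>\<^sup>+ \<zeta>. g \<zeta> \<partial>IT.eP (Suc n) \<xi>) = G \<xi>" .
  qed
  also have "\<dots> = (\<integral>\<^sup>+ \<omega>. G (restrict \<omega> {0..<Suc n}) \<partial>path_law z)"
    by (rule nn_integral_path_law_C[OF z G, symmetric])
  also have "\<dots> = (\<integral>\<^sup>+ \<omega>. G \<omega> \<partial>path_law z)"
    by (simp add: G_def cong: if_cong)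
  finally show ?thesis unfolding G_def .
qed

section \<open>Markov property\<close>

lemma measurable_overwrite:
  "(\<lambda>((a, \<omega>), w) k. if k \<le> n then \<omega> k else w) \<in> (A \<Otimes>\<^sub>M paths) \<Otimes>\<^sub>M states \<rightarrow>\<^sub>M paths"
  unfolding case_prod_unfold
proof (intro measurable_PiM_single')
  fix k :: nat
  show "(\<lambda>x. if k \<le> n then snd (fst x) k else snd x) \<in> (A \<Otimes>\<^sub>M paths) \<Otimes>\<^sub>M states \<rightarrow>\<^sub>M states"
    by (cases "k \<le> n") simp_all
qed (auto simp: space_PiM PiE_iff space_pair_measure)

lemma measurable_coordinate: "(\<lambda>\<omega>. \<omega> n) \<in> paths \<rightarrow>\<^sub>M states"
  by (rule measurable_component_singleton) simp

text \<open>
  Induction on \<open>n\<close>: integrating out the last state turns a function of the path up to time \<open>n + 1\<close>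
  into a function of the path up to time \<open>n\<close>, and keeps joint measurability in the parameter. The
  parameter is what lets the induction go through, and the starting point may depend on it.
\<close>

lemma measurable_frozen_path_integral:
  assumes f: "(\<lambda>(a, \<omega>). f a \<omega>) \<in> borel_measurable (A \<Otimes>\<^sub>M paths)"
    and g: "g \<in> A \<rightarrow>\<^sub>M states"
  shows "(\<lambda>a. \<integral>\<^sup>+ \<omega>. f a (\<lambda>k. \<omega> (min k n)) \<partial>path_law (g a)) \<in> borel_measurable A"
  using f
proof (induction n arbitrary: f)
  case 0
  have "(\<lambda>a _. g a) \<in> A \<rightarrow>\<^sub>M paths"
  proof (rule measurable_PiM_single')
    show "(\<lambda>a _. g a) \<in> space A \<rightarrow> (\<Pi>\<^sub>E i\<in>UNIV. space states)"
      using measurable_space[OF g] by (simp add: Pi_iff PiE_iff)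
  qed (rule g)
  then have "(\<lambda>a. (a, \<lambda>_. g a)) \<in> A \<rightarrow>\<^sub>M A \<Otimes>\<^sub>M paths"
    by (rule measurable_Pair[OF measurable_ident_sets[OF refl]])
  from measurable_compose[OF this 0]
  have "(\<lambda>a. f a (\<lambda>_. g a)) \<in> borel_measurable A" by simp
  moreover have "(\<integral>\<^sup>+ \<omega>. f a (\<lambda>k. \<omega> (min k 0)) \<partial>path_law (g a)) = f a (\<lambda>_. g a)"
    if a: "a \<in> space A" for a
    using measurable_space[OF g a] measurable_Pair2[OF 0 a] by (intro nn_integral_path_law_0) auto
  ultimately show ?case
    by (subst measurable_cong)
next
  case (Suc n)
  define h where
    "h a \<omega> = (\<integral>\<^sup>+ w. f a (\<lambda>k. if k \<le> n then \<omega> k else w) \<partial>trans_kernel M (\<omega> n))" for a \<omega>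
  have "(\<lambda>(a, \<omega>). h a \<omega>) \<in> borel_measurable (A \<Otimes>\<^sub>M paths)"
    unfolding h_def case_prod_unfold
  proof (rule nn_integral_measurable_subprob_algebra2)
    have "(\<lambda>x. (fst (fst x), \<lambda>k. if k \<le> n then snd (fst x) k else snd x))
        \<in> (A \<Otimes>\<^sub>M paths) \<Otimes>\<^sub>M states \<rightarrow>\<^sub>M A \<Otimes>\<^sub>M paths"
      using measurable_overwrite[of n A]
      by (intro measurable_Pair measurable_compose[OF measurable_fst measurable_fst])
         (simp add: case_prod_unfold)
    from measurable_compose[OF this Suc.prems]
    show "(\<lambda>(x, w). f (fst x) (\<lambda>k. if k \<le> n then snd x k else w))
        \<in> borel_measurable ((A \<Otimes>\<^sub>M paths) \<Otimes>\<^sub>M states)"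
      by (simp add: case_prod_unfold)
    show "(\<lambda>x. trans_kernel M (snd x n)) \<in> A \<Otimes>\<^sub>M paths \<rightarrow>\<^sub>M subprob_algebra states"
      by (rule measurable_compose[OF measurable_compose[OF measurable_snd measurable_coordinate]
            measurable_trans_kernel_subprob])
  qed
  from Suc.IH[OF this]
  have "(\<lambda>a. \<integral>\<^sup>+ \<omega>. h a (\<lambda>k. \<omega> (min k n)) \<partial>path_law (g a)) \<in> borel_measurable A" .
  moreover have "(\<integral>\<^sup>+ \<omega>. f a (\<lambda>k. \<omega> (min k (Suc n))) \<partial>path_law (g a)) =
      (\<integral>\<^sup>+ \<omega>. h a (\<lambda>k. \<omega> (min k n)) \<partial>path_law (g a))"
    if a: "a \<in> space A" for a
    using nn_integral_path_law_Suc[OF measurable_space[OF g a], of "f a" n]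
      measurable_Pair2[OF Suc.prems a]
    by (simp add: h_def min_def cong: if_cong)
  ultimately show ?case
    by (subst measurable_cong)
qed

text \<open>
  A cylinder set over coordinates up to \<open>n\<close> does not notice the freezing at time \<open>n\<close>, so statements
  about frozen paths reach the generator of the product \<open>\<sigma>\<close>-algebra.
\<close>

lemma cylinder_freeze:
  assumes I: "finite I" "I \<subseteq> {..n}" and \<omega>: "\<omega> \<in> space paths"
  shows "(\<lambda>k. \<omega> (min k n)) \<in> prod_emb UNIV (\<lambda>_. states) I (Pi\<^sub>E I A) \<longleftrightarrow>
    \<omega> \<in> prod_emb UNIV (\<lambda>_. states) I (Pi\<^sub>E I A)"
proof -
  have "min k n = k" if "k \<in> I" for k
    using that I by auto
  then show ?thesis
    using \<omega> by (auto simp: prod_emb_def space_PiM PiE_iff)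
qed

lemma measurable_path_law: "path_law \<in> states \<rightarrow>\<^sub>M prob_algebra paths"
proof (rule measurable_prob_algebra_generated[OF sets_PiM Int_stable_prod_algebra
      prod_algebra_sets_into_space])
  fix C :: "(nat \<Rightarrow> 'x \<times> 'y) set" assume "C \<in> prod_algebra UNIV (\<lambda>_. states)"
  then obtain I A where C: "C = prod_emb UNIV (\<lambda>_. states) I (Pi\<^sub>E I A)"
    and I: "finite I" and A: "\<And>i. i \<in> I \<Longrightarrow> A i \<in> sets states"
    by (auto elim!: prod_algebraE)
  have Csets: "C \<in> sets paths"
    unfolding C using I A by (intro sets_PiM_I) auto
  obtain n where n: "I \<subseteq> {..n}"
    using I by (meson finite_nat_set_iff_bounded_le atMost_iff subsetI)
  have "(\<lambda>z. \<integral>\<^sup>+ \<omega>. (\<lambda>_. indicator C) z (\<lambda>k. \<omega> (min k n)) \<partial>path_law z) \<in> borel_measurable states"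
    using Csets by (intro measurable_frozen_path_integral) auto
  moreover have "emeasure (path_law z) C = (\<integral>\<^sup>+ \<omega>. indicator C (\<lambda>k. \<omega> (min k n)) \<partial>path_law z)"
    if z: "z \<in> space states" for z
  proof -
    have "emeasure (path_law z) C = (\<integral>\<^sup>+ \<omega>. indicator C \<omega> \<partial>path_law z)"
      using Csets z by simp
    also have "\<dots> = (\<integral>\<^sup>+ \<omega>. indicator C (\<lambda>k. \<omega> (min k n)) \<partial>path_law z)"
    proof (rule nn_integral_cong)
      fix \<omega> assume "\<omega> \<in> space (path_law z)"
      then show "(indicator C \<omega> :: ennreal) = indicator C (\<lambda>k. \<omega> (min k n))"
        using cylinder_freeze[OF I n, of \<omega> A] z unfolding C by (auto simp: indicator_def)
    qed
    finally show ?thesis .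
  qed
  ultimately show "(\<lambda>z. emeasure (path_law z) C) \<in> borel_measurable states"
    by (subst measurable_cong)
qed (rule prob_space_path_law sets_path_law; assumption)+

lemmas measurable_path_law_subprob = measurable_prob_algebraD[OF measurable_path_law]

lemma measurable_case_nat_path: "(\<lambda>(z, \<omega>). case_nat z \<omega>) \<in> states \<Otimes>\<^sub>M paths \<rightarrow>\<^sub>M paths"
  unfolding case_prod_unfold by measurable

lemma measurable_prepend: "z \<in> space states \<Longrightarrow> case_nat z \<in> paths \<rightarrow>\<^sub>M paths"
  using measurable_Pair2[OF measurable_case_nat_path, of z] by simp

text \<open>
  The construction of the path law appends states at the end, whereas the Markov property splits off
  the first state. Induction on \<open>n\<close> passes from one to the other: integrate out the last state,
  split off the first state of the shorter path, and put the last state back under the law started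
  afresh. The last step needs the case \<open>n = 0\<close> apart, because then the last state is the only one
  after \<open>z\<close>.
\<close>

lemma frozen_markov:
  assumes z: "z \<in> space states" and f: "f \<in> borel_measurable paths"
  shows "(\<integral>\<^sup>+ \<omega>. f (\<lambda>k. \<omega> (min k n)) \<partial>path_law z) =
    (\<integral>\<^sup>+ z'. (\<integral>\<^sup>+ \<omega>. f (\<lambda>k. case_nat z \<omega> (min k n)) \<partial>path_law z') \<partial>trans_kernel M z)"
  using f
proof (induction n arbitrary: f)
  case 0
  have "(\<integral>\<^sup>+ z'. (\<integral>\<^sup>+ \<omega>. f (\<lambda>k. case_nat z \<omega> (min k 0)) \<partial>path_law z') \<partial>trans_kernel M z) =
      (\<integral>\<^sup>+ z'. f (\<lambda>_. z) \<partial>trans_kernel M z)"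
  proof (rule nn_integral_cong)
    fix z' assume "z' \<in> space (trans_kernel M z)"
    then have "z' \<in> space states"
      using subprob_measurableD(1)[OF measurable_trans_kernel_subprob z] by simp
    then interpret P: prob_space "path_law z'" by (rule prob_space_path_law)
    show "(\<integral>\<^sup>+ \<omega>. f (\<lambda>k. case_nat z \<omega> (min k 0)) \<partial>path_law z') = f (\<lambda>_. z)"
      by (simp add: P.emeasure_space_1)
  qed
  also have "\<dots> = f (\<lambda>_. z)"
  proof -
    interpret K: prob_space "trans_kernel M z"
      using z by (intro trans_kernel_prob) (simp add: space_states)
    show ?thesis by (simp add: K.emeasure_space_1)
  qed
  finally show ?case
    using nn_integral_path_law_0[OF z 0] by simp
next
  case (Suc n)
  define h where "h \<omega> = (\<integral>\<^sup>+ w. f (\<lambda>k. if k \<le> n then \<omega> k else w) \<partial>trans_kernel M (\<omega> n))" for \<omega>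
  have h: "h \<in> borel_measurable paths"
  proof -
    have "(\<lambda>\<omega>. restrict \<omega> {0..<Suc n}) \<in> paths \<rightarrow>\<^sub>M PiM {0..<Suc n} (\<lambda>_. states)"
      by (rule measurable_restrict_subset) auto
    from measurable_compose[OF this measurable_step_integral[OF Suc.prems]]
    show ?thesis unfolding h_def by (simp cong: if_cong)
  qed
  have f': "(\<lambda>\<omega>. f (case_nat z \<omega>)) \<in> borel_measurable paths"
    by (rule measurable_compose[OF measurable_prepend[OF z] Suc.prems])
  have shift: "(\<lambda>k. case_nat z \<omega> (min k (Suc m))) = case_nat z (\<lambda>k. \<omega> (min k m))" for \<omega> m
    by (auto simp: fun_eq_iff split: nat.split)
  have "(\<integral>\<^sup>+ \<omega>. f (\<lambda>k. \<omega> (min k (Suc n))) \<partial>path_law z) =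
      (\<integral>\<^sup>+ \<omega>. h (\<lambda>k. \<omega> (min k n)) \<partial>path_law z)"
    using nn_integral_path_law_Suc[OF z Suc.prems, of n] by (simp add: h_def min_def cong: if_cong)
  also have "\<dots> =
      (\<integral>\<^sup>+ z'. (\<integral>\<^sup>+ \<omega>. h (\<lambda>k. case_nat z \<omega> (min k n)) \<partial>path_law z') \<partial>trans_kernel M z)"
    by (rule Suc.IH[OF h])
  also have "\<dots> =
      (\<integral>\<^sup>+ z'. (\<integral>\<^sup>+ \<omega>. f (\<lambda>k. case_nat z \<omega> (min k (Suc n))) \<partial>path_law z') \<partial>trans_kernel M z)"
  proof (cases n)
    case 0
    have "(\<integral>\<^sup>+ z'. (\<integral>\<^sup>+ \<omega>. h (\<lambda>k. case_nat z \<omega> (min k n)) \<partial>path_law z') \<partial>trans_kernel M z) =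
        (\<integral>\<^sup>+ z'. h (\<lambda>_. z) \<partial>trans_kernel M z)"
    proof (rule nn_integral_cong)
      fix z' assume "z' \<in> space (trans_kernel M z)"
      then have "z' \<in> space states"
        using subprob_measurableD(1)[OF measurable_trans_kernel_subprob z] by simp
      then interpret P: prob_space "path_law z'" by (rule prob_space_path_law)
      show "(\<integral>\<^sup>+ \<omega>. h (\<lambda>k. case_nat z \<omega> (min k n)) \<partial>path_law z') = h (\<lambda>_. z)"
        using 0 by (simp add: P.emeasure_space_1)
    qed
    also have "\<dots> = h (\<lambda>_. z)"
    proof -
      interpret K: prob_space "trans_kernel M z"
        using z by (intro trans_kernel_prob) (simp add: space_states)
      show ?thesis by (simp add: K.emeasure_space_1)
    qed
    also have "\<dots> = (\<integral>\<^sup>+ w. f (case_nat z (\<lambda>_. w)) \<partial>trans_kernel M z)"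
    proof -
      have "(\<lambda>k. if k \<le> 0 then z else w) = case_nat z (\<lambda>_. w)" for w
        by (auto simp: fun_eq_iff split: nat.split)
      then show ?thesis by (simp add: h_def 0)
    qed
    also have "\<dots> = (\<integral>\<^sup>+ z'. (\<integral>\<^sup>+ \<omega>. f (\<lambda>k. case_nat z \<omega> (min k (Suc n))) \<partial>path_law z')
        \<partial>trans_kernel M z)"
    proof (rule nn_integral_cong)
      fix z' assume "z' \<in> space (trans_kernel M z)"
      then have "z' \<in> space states"
        using subprob_measurableD(1)[OF measurable_trans_kernel_subprob z] by simp
      from nn_integral_path_law_0[OF this f']
      show "f (case_nat z (\<lambda>_. z')) =
          (\<integral>\<^sup>+ \<omega>. f (\<lambda>k. case_nat z \<omega> (min k (Suc n))) \<partial>path_law z')"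
        unfolding shift 0 by simp
    qed
    finally show ?thesis .
  next
    case (Suc m)
    have step: "h (\<lambda>k. case_nat z \<omega> (min k n)) =
        (\<integral>\<^sup>+ w. f (case_nat z (\<lambda>k. if k \<le> m then \<omega> k else w)) \<partial>trans_kernel M (\<omega> m))" for \<omega>
    proof -
      have "(\<lambda>k. if k \<le> Suc m then case_nat z \<omega> (min k (Suc m)) else w) =
          case_nat z (\<lambda>k. if k \<le> m then \<omega> k else w)" for w
        by (auto simp: fun_eq_iff min_def split: nat.split)
      then show ?thesis by (simp add: h_def Suc)
    qed
    show ?thesis
    proof (rule nn_integral_cong)
      fix z' assume "z' \<in> space (trans_kernel M z)"
      then have "z' \<in> space states"
        using subprob_measurableD(1)[OF measurable_trans_kernel_subprob z] by simp
      from nn_integral_path_law_Suc[OF this f', of m]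
      show "(\<integral>\<^sup>+ \<omega>. h (\<lambda>k. case_nat z \<omega> (min k n)) \<partial>path_law z') =
          (\<integral>\<^sup>+ \<omega>. f (\<lambda>k. case_nat z \<omega> (min k (Suc n))) \<partial>path_law z')"
        unfolding step unfolding shift Suc by simp
    qed
  qed
  finally show ?case .
qed

lemma sets_trans_kernel: "z \<in> space states \<Longrightarrow> sets (trans_kernel M z) = sets states"
  and space_trans_kernel: "z \<in> space states \<Longrightarrow> space (trans_kernel M z) = space states"
  by (rule subprob_measurableD[OF measurable_trans_kernel_subprob], assumption)+

lemma measurable_shifted_law:
  assumes "z \<in> space states"
  shows "(\<lambda>z'. distr (path_law z') paths (case_nat z)) \<in> states \<rightarrow>\<^sub>M prob_algebra paths"
  by (rule measurable_compose[OF measurable_path_law measurable_distr_prob_space])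
     (rule measurable_prepend[OF assms])

lemma measurable_path_law_iff: "z \<in> space states \<Longrightarrow> f \<in> path_law z \<rightarrow>\<^sub>M N \<longleftrightarrow> f \<in> paths \<rightarrow>\<^sub>M N"
  by (simp cong: measurable_cong_sets)

text \<open>
  Both measures agree on cylinder sets by \<open>frozen_markov\<close>.
\<close>

lemma path_law_eq_bind:
  assumes z: "z \<in> space states"
  shows "path_law z = trans_kernel M z \<bind> (\<lambda>z'. distr (path_law z') paths (case_nat z))"
proof (rule measure_eqI_PiM_infinite)
  interpret P: prob_space "path_law z" using z by (rule prob_space_path_law)
  show "finite_measure (path_law z)" by (rule P.finite_measure_axioms)
  interpret K: prob_space "trans_kernel M z"
    using z by (intro trans_kernel_prob) (simp add: space_states)
  show "sets (path_law z) = sets paths" using z by simp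
  let ?D = "\<lambda>z'. distr (path_law z') paths (case_nat z)"
  have D: "?D \<in> trans_kernel M z \<rightarrow>\<^sub>M subprob_algebra paths"
    using measurable_prob_algebraD[OF measurable_shifted_law[OF z]]
      measurable_cong_sets[OF sets_trans_kernel[OF z] refl] by blast
  show "sets (trans_kernel M z \<bind> ?D) = sets paths"
    using K.not_empty by simp
  fix A and I :: "nat set"
  assume I: "finite I" and A: "\<And>i. i \<in> I \<Longrightarrow> A i \<in> sets states"
  define C where "C = prod_emb UNIV (\<lambda>_. states) I (Pi\<^sub>E I A)"
  have C: "C \<in> sets paths"
    unfolding C_def using I A by (intro sets_PiM_I) auto
  obtain n where n: "I \<subseteq> {..n}"
    using I by (meson finite_nat_set_iff_bounded_le atMost_iff subsetI)
  have "emeasure (path_law z) C = (\<integral>\<^sup>+ \<omega>. indicator C \<omega> \<partial>path_law z)"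
    using C z by simp
  also have "\<dots> = (\<integral>\<^sup>+ \<omega>. indicator C (\<lambda>k. \<omega> (min k n)) \<partial>path_law z)"
    using cylinder_freeze[OF I n, of _ A] z
    by (intro nn_integral_cong) (auto simp: indicator_def C_def)
  also have "\<dots> = (\<integral>\<^sup>+ z'. (\<integral>\<^sup>+ \<omega>. indicator C (\<lambda>k. case_nat z \<omega> (min k n)) \<partial>path_law z')
      \<partial>trans_kernel M z)"
    using C by (intro frozen_markov[OF z]) auto
  also have "\<dots> = (\<integral>\<^sup>+ z'. emeasure (?D z') C \<partial>trans_kernel M z)"
  proof (rule nn_integral_cong)
    fix z' assume "z' \<in> space (trans_kernel M z)"
    then have z': "z' \<in> space states" using z by (simp add: space_trans_kernel)
    have "emeasure (?D z') C = (\<integral>\<^sup>+ \<omega>. indicator C \<omega> \<partial>?D z')"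
      using C by simp
    also have "\<dots> = (\<integral>\<^sup>+ \<omega>. indicator C (case_nat z \<omega>) \<partial>path_law z')"
      using C by (intro nn_integral_distr)
        (simp_all add: measurable_path_law_iff[OF z'] measurable_prepend[OF z])
    also have "\<dots> = (\<integral>\<^sup>+ \<omega>. indicator C (\<lambda>k. case_nat z \<omega> (min k n)) \<partial>path_law z')"
      using cylinder_freeze[OF I n case_nat_in_paths[OF z], of _ A] z'
      by (intro nn_integral_cong) (auto simp: indicator_def C_def)
    finally show "(\<integral>\<^sup>+ \<omega>. indicator C (\<lambda>k. case_nat z \<omega> (min k n)) \<partial>path_law z') =
        emeasure (?D z') C" ..
  qed
  also have "\<dots> = emeasure (trans_kernel M z \<bind> ?D) C"
    by (rule emeasure_bind[OF K.not_empty D C, symmetric])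
  finally show "emeasure (path_law z) (prod_emb UNIV (\<lambda>_. states) I (Pi\<^sub>E I A)) =
      emeasure (trans_kernel M z \<bind> ?D) (prod_emb UNIV (\<lambda>_. states) I (Pi\<^sub>E I A))"
    unfolding C_def .
qed

lemma nn_integral_path_law:
  assumes z: "z \<in> space states" and f: "f \<in> borel_measurable paths"
  shows "(\<integral>\<^sup>+ \<omega>. f \<omega> \<partial>path_law z) =
    (\<integral>\<^sup>+ z'. (\<integral>\<^sup>+ \<omega>. f (case_nat z \<omega>) \<partial>path_law z') \<partial>trans_kernel M z)"
proof -
  have D: "(\<lambda>z'. distr (path_law z') paths (case_nat z)) \<in> trans_kernel M z \<rightarrow>\<^sub>M subprob_algebra paths"
    using measurable_prob_algebraD[OF measurable_shifted_law[OF z]]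
      measurable_cong_sets[OF sets_trans_kernel[OF z] refl] by blast
  have "(\<integral>\<^sup>+ \<omega>. f \<omega> \<partial>path_law z) =
      (\<integral>\<^sup>+ z'. (\<integral>\<^sup>+ \<omega>. f \<omega> \<partial>distr (path_law z') paths (case_nat z)) \<partial>trans_kernel M z)"
    by (subst path_law_eq_bind[OF z]) (rule nn_integral_bind[OF f D])
  also have "\<dots> = (\<integral>\<^sup>+ z'. (\<integral>\<^sup>+ \<omega>. f (case_nat z \<omega>) \<partial>path_law z') \<partial>trans_kernel M z)"
  proof (rule nn_integral_cong)
    fix z' assume "z' \<in> space (trans_kernel M z)"
    then have z': "z' \<in> space states" using z by (simp add: space_trans_kernel)
    show "(\<integral>\<^sup>+ \<omega>. f \<omega> \<partial>distr (path_law z') paths (case_nat z)) =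
        (\<integral>\<^sup>+ \<omega>. f (case_nat z \<omega>) \<partial>path_law z')"
      using f by (intro nn_integral_distr)
        (simp_all add: measurable_path_law_iff[OF z'] measurable_prepend[OF z])
  qed
  finally show ?thesis .
qed

section \<open>Stopping times of the observed process\<close>

lemma sets_obs_filtration: "sets (obs_filtration M n) = sigma_sets (space paths)
     {(\<lambda>\<omega>. fst (\<omega> k)) -` A \<inter> space paths | k A. k \<le> n \<and> A \<in> sets (BX M)}"
  unfolding obs_filtration_def path_space_def by (rule sets_measure_of) auto

lemma space_obs_filtration: "space (obs_filtration M n) = space paths"
  unfolding obs_filtration_def path_space_def by (rule space_measure_of) auto

lemma measurable_obs_coordinate:
  assumes "k \<le> n" shows "(\<lambda>\<omega>. fst (\<omega> k)) \<in> obs_filtration M n \<rightarrow>\<^sub>M BX M"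
proof (rule measurableI)
  show "fst (\<omega> k) \<in> space (BX M)" if "\<omega> \<in> space (obs_filtration M n)" for \<omega>
    using that path_in_spaceX by (simp add: space_obs_filtration space_BX)
  show "(\<lambda>\<omega>. fst (\<omega> k)) -` A \<inter> space (obs_filtration M n) \<in> sets (obs_filtration M n)"
    if "A \<in> sets (BX M)" for A
    using that assms unfolding sets_obs_filtration space_obs_filtration
    by (intro sigma_sets.Basic) auto
qed

lemma measurable_into_obs_filtration:
  assumes f: "f \<in> space N \<rightarrow> space paths"
    and g: "\<And>k. k \<le> n \<Longrightarrow> (\<lambda>\<omega>. fst (f \<omega> k)) \<in> N \<rightarrow>\<^sub>M BX M"
  shows "f \<in> N \<rightarrow>\<^sub>M obs_filtration M n"
  unfolding obs_filtration_def path_space_def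
proof (rule measurable_measure_of)
  fix C assume "C \<in> {(\<lambda>\<omega>. fst (\<omega> k)) -` A \<inter> space paths | k A. k \<le> n \<and> A \<in> sets (BX M)}"
  then obtain k A where C: "C = (\<lambda>\<omega>. fst (\<omega> k)) -` A \<inter> space paths" "k \<le> n" "A \<in> sets (BX M)"
    by auto
  have "f -` C \<inter> space N = (\<lambda>\<omega>. fst (f \<omega> k)) -` A \<inter> space N"
    using f by (auto simp: C)
  with measurable_sets[OF g[OF C(2)] C(3)] show "f -` C \<inter> space N \<in> sets N"
    by simp
qed (use f in auto)

lemma obs_filtration_le: "sets (obs_filtration M n) \<subseteq> sets paths"
  unfolding sets_obs_filtration
proof (rule sets.sigma_sets_subset, safe)
  fix k A assume "A \<in> sets (BX M)"
  then show "(\<lambda>\<omega>. fst (\<omega> k)) -` A \<inter> space paths \<in> sets paths"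
    by (rule measurable_sets[OF measurable_compose[OF measurable_coordinate measurable_fst]])
qed

text \<open>
  The paths with prescribed observations up to time \<open>n\<close> lie either all inside or all outside of an event
  observable at time \<open>n\<close>, since this is true for the generators and is preserved by complements
  and countable unions.
\<close>

lemma obs_filtration_saturated:
  assumes "C \<in> sets (obs_filtration M n)" "\<omega> \<in> space paths" "\<omega>' \<in> space paths"
    and "\<And>k. k \<le> n \<Longrightarrow> fst (\<omega> k) = fst (\<omega>' k)"
  shows "\<omega> \<in> C \<longleftrightarrow> \<omega>' \<in> C"
  using assms(1) unfolding sets_obs_filtration
proof (induction rule: sigma_sets.induct)
  case (Basic a)
  then show ?case using assms by auto
qed (use assms in auto)

lemma stopping_timesD:
  assumes "\<tau> \<in> stopping_times M n"
  shows "{\<omega> \<in> space paths. \<tau> \<omega> \<le> k} \<in> sets (obs_filtration M k)"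
    and "\<omega> \<in> space paths \<Longrightarrow> \<tau> \<omega> \<le> n"
  using assms
  by (auto simp: stopping_times_def stopping_time_def pred_def space_obs_filtration path_space_def)

lemma stopping_timesI:
  assumes "\<And>k. {\<omega> \<in> space paths. \<tau> \<omega> \<le> k} \<in> sets (obs_filtration M k)"
    and "\<And>\<omega>. \<omega> \<in> space paths \<Longrightarrow> \<tau> \<omega> \<le> n"
  shows "\<tau> \<in> stopping_times M n"
  using assms
  by (auto simp: stopping_times_def stopping_time_def pred_def space_obs_filtration path_space_def)

lemma stopping_times_mono: "n \<le> m \<Longrightarrow> \<tau> \<in> stopping_times M n \<Longrightarrow> \<tau> \<in> stopping_times M m"
  by (fastforce simp: stopping_times_def)

lemma zero_stopping_time: "(\<lambda>_. 0) \<in> stopping_times M n"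
  by (simp add: stopping_times_def stopping_time_const)

lemma measurable_stopping_times:
  assumes "\<tau> \<in> stopping_times M n"
  shows "\<tau> \<in> paths \<rightarrow>\<^sub>M count_space UNIV"
proof -
  have "stopping_time (obs_filtration M) \<tau>"
    using assms by (simp add: stopping_times_def)
  from measurable_stopping_time[OF this, of paths]
  show ?thesis
    using obs_filtration_le
    by (simp add: space_obs_filtration measurable_cong_sets[OF refl sets_borel_eq_count_space])
qed

text \<open>
  A stopping time looks no further than itself, because for every \<open>k \<le> \<tau> \<omega>\<close> the event \<open>\<tau> \<le> k\<close> is
  decided by the observations up to time \<open>k\<close>, in which the two paths agree.
\<close>

lemma stopping_times_cong:
  assumes \<tau>: "\<tau> \<in> stopping_times M n" and \<omega>: "\<omega> \<in> space paths" "\<omega>' \<in> space paths"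
    and eq: "\<And>k. k \<le> \<tau> \<omega> \<Longrightarrow> fst (\<omega> k) = fst (\<omega>' k)"
  shows "\<tau> \<omega>' = \<tau> \<omega>"
proof -
  have le: "\<tau> \<omega> \<le> k \<longleftrightarrow> \<tau> \<omega>' \<le> k" if "k \<le> \<tau> \<omega>" for k
    using obs_filtration_saturated[OF stopping_timesD(1)[OF \<tau>, of k] \<omega>] eq that \<omega> by auto
  have "\<tau> \<omega>' \<le> \<tau> \<omega>" using le[of "\<tau> \<omega>"] by simp
  moreover have "\<not> \<tau> \<omega>' < \<tau> \<omega>"
    using le[of "\<tau> \<omega>'"] by auto
  ultimately show ?thesis by simp
qed

lemma measurable_cost [measurable]: "cost M \<in> borel_measurable (BX M)"
  and measurable_gain [measurable]: "gain M \<in> borel_measurable (BX M)"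
  by (fact cost_measurable gain_measurable)+

lemma measurable_util [measurable]: "util M \<in> borel_measurable borel"
  by (rule borel_measurable_mono) (rule strict_mono_mono[OF util_strict_mono])

lemma measurable_obs [measurable]: "(\<lambda>\<omega>. fst (\<omega> k)) \<in> paths \<rightarrow>\<^sub>M BX M"
  by (rule measurable_compose[OF measurable_coordinate measurable_fst])

lemma measurable_utility:
  assumes "\<tau> \<in> stopping_times M n"
  shows "utility M s \<tau> \<in> borel_measurable paths"
proof -
  have [measurable]: "\<tau> \<in> paths \<rightarrow>\<^sub>M count_space UNIV"
    by (rule measurable_stopping_times[OF assms])
  have "(\<lambda>\<omega>. (\<lambda>t \<omega>. util M ((\<Sum>k<t. cost M (fst (\<omega> k))) + s + gain M (fst (\<omega> t)))) (\<tau> \<omega>) \<omega>)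
      \<in> borel_measurable paths"
    by (rule measurable_compose_countable) measurable
  then show ?thesis
    unfolding utility_def .
qed

lemma delayed_stopping_time:
  assumes \<tau>: "\<tau> \<in> stopping_times M n"
  shows "(\<lambda>\<omega>. Suc (\<tau> (\<lambda>k. \<omega> (Suc k)))) \<in> stopping_times M (Suc n)"
proof (rule stopping_timesI)
  have sp: "(\<lambda>k. \<omega> (Suc k)) \<in> space paths" if "\<omega> \<in> space paths" for \<omega>
    using that by (auto simp: space_PiM PiE_iff)
  fix k
  show "{\<omega> \<in> space paths. Suc (\<tau> (\<lambda>k. \<omega> (Suc k))) \<le> k} \<in> sets (obs_filtration M k)"
  proof (cases k)
    case 0
    then show ?thesis by simp
  next
    case (Suc j)
    have "(\<lambda>\<omega> k. \<omega> (Suc k)) \<in> obs_filtration M k \<rightarrow>\<^sub>M obs_filtration M j"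
      using Suc sp by (intro measurable_into_obs_filtration measurable_obs_coordinate)
        (auto simp: space_obs_filtration)
    from measurable_sets[OF this stopping_timesD(1)[OF \<tau>, of j]]
    have "(\<lambda>\<omega> k. \<omega> (Suc k)) -` {\<omega> \<in> space paths. \<tau> \<omega> \<le> j} \<inter> space paths \<in> sets (obs_filtration M k)"
      by (simp add: space_obs_filtration)
    also have "(\<lambda>\<omega> k. \<omega> (Suc k)) -` {\<omega> \<in> space paths. \<tau> \<omega> \<le> j} \<inter> space paths =
        {\<omega> \<in> space paths. Suc (\<tau> (\<lambda>k. \<omega> (Suc k))) \<le> k}"
      using Suc sp by auto
    finally show ?thesis .
  qed
  show "Suc (\<tau> (\<lambda>k. \<omega> (Suc k))) \<le> Suc n" if "\<omega> \<in> space paths" for \<omega>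
    using stopping_timesD(2)[OF \<tau> sp[OF that]] by simp
qed

text \<open>
  Prepending \<open>z\<close> turns what is observed up to time \<open>k\<close> into what is observed up to time \<open>k + 1\<close>, so
  \<open>\<tau> \<le> k + 1\<close> becomes an event observable at time \<open>k\<close>.
\<close>

lemma residual_stopping_time:
  assumes \<tau>: "\<tau> \<in> stopping_times M (Suc n)" and z: "z \<in> space states"
  shows "(\<lambda>\<omega>. \<tau> (case_nat z \<omega>) - 1) \<in> stopping_times M n"
proof (rule stopping_timesI)
  fix k
  have "(\<lambda>\<omega>. fst (case_nat z \<omega> j)) \<in> obs_filtration M k \<rightarrow>\<^sub>M BX M" if "j \<le> Suc k" for j
  proof (cases j)
    case 0
    then show ?thesis
      using measurable_space[OF measurable_fst z] by (simp only: nat.case measurable_const)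
  next
    case (Suc i)
    then show ?thesis
      using that by (simp only: nat.case Suc_le_mono measurable_obs_coordinate)
  qed
  then have "case_nat z \<in> obs_filtration M k \<rightarrow>\<^sub>M obs_filtration M (Suc k)"
    using case_nat_in_paths[OF z]
    by (intro measurable_into_obs_filtration) (auto simp: space_obs_filtration)
  from measurable_sets[OF this stopping_timesD(1)[OF \<tau>, of "Suc k"]]
  have "case_nat z -` {\<omega> \<in> space paths. \<tau> \<omega> \<le> Suc k} \<inter> space paths \<in> sets (obs_filtration M k)"
    by (simp add: space_obs_filtration)
  also have "case_nat z -` {\<omega> \<in> space paths. \<tau> \<omega> \<le> Suc k} \<inter> space paths =
      {\<omega> \<in> space paths. \<tau> (case_nat z \<omega>) - 1 \<le> k}"
    using case_nat_in_paths[OF z] by auto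
  finally show "{\<omega> \<in> space paths. \<tau> (case_nat z \<omega>) - 1 \<le> k} \<in> sets (obs_filtration M k)" .
  show "\<tau> (case_nat z \<omega>) - 1 \<le> n" if "\<omega> \<in> space paths" for \<omega>
    using stopping_timesD(2)[OF \<tau> case_nat_in_paths[OF z that]] by simp
qed

lemma utility_Suc:
  assumes "\<tau> (case_nat z \<omega>) = Suc (\<tau>' \<omega>)"
  shows "utility M s \<tau> (case_nat z \<omega>) = utility M (s + cost M (fst z)) \<tau>' \<omega>"
  unfolding utility_def assms by (simp add: sum.lessThan_Suc_shift algebra_simps del: sum.lessThan_Suc)

lemma utility_0:
  assumes "\<tau> (case_nat z \<omega>) = 0"
  shows "utility M s \<tau> (case_nat z \<omega>) = util M (gain M (fst z) + s)"
  unfolding utility_def assms by (simp add: algebra_simps)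

section \<open>Bayes formula for the filter\<close>

text \<open>
  The density, with respect to the reference measures, of the next state when the current observation
  is \<open>x\<close> and the current hidden state has law \<open>\<mu>\<close>. It is the numerator in the definition of the filter,
  and its integral over \<open>y'\<close> is the denominator.
\<close>

definition pred_dens :: "'x \<Rightarrow> 'y measure \<Rightarrow> 'x \<Rightarrow> 'y \<Rightarrow> ennreal" where
  "pred_dens x \<mu> x' y' = (\<integral>\<^sup>+ y. dens M x' y' x y \<partial>\<mu>)"

lemma measurable_dens:
  assumes "a \<in> N \<rightarrow>\<^sub>M BX M" "b \<in> N \<rightarrow>\<^sub>M BY M" "c \<in> N \<rightarrow>\<^sub>M BX M" "d \<in> N \<rightarrow>\<^sub>M BY M"
  shows "(\<lambda>p. dens M (a p) (b p) (c p) (d p)) \<in> borel_measurable N"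
  using measurable_compose[OF measurable_Pair[OF measurable_Pair[OF assms(1,2)]
    measurable_Pair[OF assms(3,4)]] dens_measurable] by simp

lemma prob_algebra_BY:
  assumes "\<mu> \<in> space (prob_algebra (BY M))"
  shows "prob_space \<mu>" "sets \<mu> = sets (BY M)" "space \<mu> = spaceY M"
  using assms sets_eq_imp_space_eq[of \<mu> "BY M"] by (auto simp: space_prob_algebra space_BY)

lemma measurable_refX_iff: "f \<in> refX M \<rightarrow>\<^sub>M N \<longleftrightarrow> f \<in> BX M \<rightarrow>\<^sub>M N"
  by (simp only: measurable_cong_sets[OF sets_refX refl])

lemma measurable_refY_iff: "f \<in> refY M \<rightarrow>\<^sub>M N \<longleftrightarrow> f \<in> BY M \<rightarrow>\<^sub>M N"
  by (simp only: measurable_cong_sets[OF sets_refY refl])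

lemma space_refX: "space (refX M) = spaceX M" and space_refY: "space (refY M) = spaceY M"
  using sets_eq_imp_space_eq[OF sets_refX] sets_eq_imp_space_eq[OF sets_refY]
  by (simp_all add: space_BX space_BY)

lemma sets_ref_pair: "sets (refX M \<Otimes>\<^sub>M refY M) = sets states"
  by (intro sets_pair_measure_cong sets_refX sets_refY)

lemma measurable_pred_dens:
  assumes x: "x \<in> N \<rightarrow>\<^sub>M BX M" and \<mu>: "\<mu> \<in> N \<rightarrow>\<^sub>M prob_algebra (BY M)"
    and x': "x' \<in> N \<rightarrow>\<^sub>M BX M" and y': "y' \<in> N \<rightarrow>\<^sub>M BY M"
  shows "(\<lambda>p. pred_dens (x p) (\<mu> p) (x' p) (y' p)) \<in> borel_measurable N"
  unfolding pred_dens_def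
proof (rule nn_integral_measurable_subprob_algebra2[where N = "BY M"])
  show "(\<lambda>(p, y). dens M (x' p) (y' p) (x p) y) \<in> borel_measurable (N \<Otimes>\<^sub>M BY M)"
    unfolding case_prod_unfold
    by (intro measurable_dens measurable_compose[OF measurable_fst] x x' y' measurable_snd)
  show "\<mu> \<in> N \<rightarrow>\<^sub>M subprob_algebra (BY M)"
    by (rule measurable_prob_algebraD[OF \<mu>])
qed

lemma nn_integral_trans_kernel:
  assumes z: "z \<in> space states" and H: "H \<in> borel_measurable states"
  shows "(\<integral>\<^sup>+ z'. H z' \<partial>trans_kernel M z) =
    (\<integral>\<^sup>+ z'. dens M (fst z') (snd z') (fst z) (snd z) * H z' \<partial>(refX M \<Otimes>\<^sub>M refY M))"
proof -
  have c: "(\<lambda>z'. dens M (fst z') (snd z') (fst z) (snd z)) \<in> borel_measurable (refX M \<Otimes>\<^sub>M refY M)"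
    unfolding measurable_cong_sets[OF sets_ref_pair refl]
    by (rule measurable_dens)
       (use measurable_space[OF measurable_fst z] measurable_space[OF measurable_snd z] in auto)
  show ?thesis
    unfolding trans_kernel_def case_prod_unfold
    by (rule nn_integral_density[OF c])
       (simp only: measurable_cong_sets[OF sets_ref_pair refl] H)
qed

lemma nn_integral_mixed_kernel:
  assumes x: "x \<in> spaceX M" and \<mu>: "\<mu> \<in> space (prob_algebra (BY M))"
    and H: "H \<in> borel_measurable states"
  shows "(\<integral>\<^sup>+ y. (\<integral>\<^sup>+ z'. H z' \<partial>trans_kernel M (x, y)) \<partial>\<mu>) =
    (\<integral>\<^sup>+ x'. (\<integral>\<^sup>+ y'. pred_dens x \<mu> x' y' * H (x', y') \<partial>refY M) \<partial>refX M)"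
proof -
  note \<mu>' = prob_algebra_BY[OF \<mu>]
  let ?R = "refX M \<Otimes>\<^sub>M refY M"
  interpret X: sigma_finite_measure "refX M" by (rule sigma_finite_refX)
  interpret Y: sigma_finite_measure "refY M" by (rule sigma_finite_refY)
  interpret XY: pair_sigma_finite "refX M" "refY M" ..
  interpret \<mu>: prob_space \<mu> by (rule \<mu>')
  interpret R: sigma_finite_measure ?R by (rule XY.P.sigma_finite_measure_axioms)
  interpret \<mu>R: pair_sigma_finite \<mu> ?R ..
  have sets_\<mu>R: "sets (\<mu> \<Otimes>\<^sub>M ?R) = sets (BY M \<Otimes>\<^sub>M states)"
    by (intro sets_pair_measure_cong \<mu>' sets_ref_pair)
  have xB: "x \<in> space (BX M)" using x by (simp add: space_BX)
  have d: "(\<lambda>p. dens M (fst (snd p)) (snd (snd p)) x (fst p)) \<in> borel_measurable (BY M \<Otimes>\<^sub>M states)"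
    by (intro measurable_dens measurable_const[OF xB] measurable_fst
          measurable_compose[OF measurable_snd measurable_fst]
          measurable_compose[OF measurable_snd measurable_snd])
  have m: "(\<lambda>(y, z'). dens M (fst z') (snd z') x y * H z') \<in> borel_measurable (\<mu> \<Otimes>\<^sub>M ?R)"
    unfolding measurable_cong_sets[OF sets_\<mu>R refl] case_prod_unfold
    by (intro borel_measurable_times_ennreal d measurable_compose[OF measurable_snd H])
  have pd: "(\<lambda>z'. pred_dens x \<mu> (fst z') (snd z')) \<in> borel_measurable states"
    by (rule measurable_pred_dens) (simp_all add: \<mu> xB)
  have "(\<integral>\<^sup>+ y. (\<integral>\<^sup>+ z'. H z' \<partial>trans_kernel M (x, y)) \<partial>\<mu>) =
      (\<integral>\<^sup>+ y. (\<integral>\<^sup>+ z'. dens M (fst z') (snd z') x y * H z' \<partial>?R) \<partial>\<mu>)"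
    using x by (intro nn_integral_cong) (simp add: nn_integral_trans_kernel[OF _ H] space_states \<mu>')
  also have "\<dots> = (\<integral>\<^sup>+ z'. (\<integral>\<^sup>+ y. dens M (fst z') (snd z') x y * H z' \<partial>\<mu>) \<partial>?R)"
    by (rule \<mu>R.Fubini'[OF m, symmetric])
  also have "\<dots> = (\<integral>\<^sup>+ z'. pred_dens x \<mu> (fst z') (snd z') * H z' \<partial>?R)"
  proof (rule nn_integral_cong)
    fix z' assume "z' \<in> space ?R"
    then have z': "z' \<in> space states" using sets_eq_imp_space_eq[OF sets_ref_pair] by simp
    have "(\<lambda>y. dens M (fst z') (snd z') x y) \<in> borel_measurable \<mu>"
      unfolding measurable_cong_sets[OF \<mu>'(2) refl]
      by (rule measurable_dens)
         (use measurable_space[OF measurable_fst z'] measurable_space[OF measurable_snd z'] xB in auto)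
    then show "(\<integral>\<^sup>+ y. dens M (fst z') (snd z') x y * H z' \<partial>\<mu>) =
        pred_dens x \<mu> (fst z') (snd z') * H z'"
      unfolding pred_dens_def by (rule nn_integral_multc)
  qed
  also have "\<dots> = (\<integral>\<^sup>+ x'. (\<integral>\<^sup>+ y'. pred_dens x \<mu> x' y' * H (x', y') \<partial>refY M) \<partial>refX M)"
  proof -
    have "(\<lambda>z'. pred_dens x \<mu> (fst z') (snd z') * H z') \<in> borel_measurable ?R"
      unfolding measurable_cong_sets[OF sets_ref_pair refl]
      by (intro borel_measurable_times_ennreal pd H)
    from Y.nn_integral_fst[OF this] show ?thesis by simp
  qed
  finally show ?thesis .
qed

text \<open>
  By Fubini, integrating the joint density over the next hidden state and averaging over the current
  one can be exchanged.
\<close>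

lemma nn_integral_dens_X:
  assumes x: "x \<in> spaceX M" and \<mu>: "\<mu> \<in> space (prob_algebra (BY M))" and x': "x' \<in> spaceX M"
  shows "(\<integral>\<^sup>+ y. dens_X M x' x y \<partial>\<mu>) = (\<integral>\<^sup>+ y'. pred_dens x \<mu> x' y' \<partial>refY M)"
proof -
  note \<mu>' = prob_algebra_BY[OF \<mu>]
  interpret Y: sigma_finite_measure "refY M" by (rule sigma_finite_refY)
  interpret \<mu>: prob_space \<mu> by (rule \<mu>')
  interpret P: pair_sigma_finite "refY M" \<mu> ..
  have s: "sets (refY M \<Otimes>\<^sub>M \<mu>) = sets (BY M \<Otimes>\<^sub>M BY M)"
    by (intro sets_pair_measure_cong \<mu>' sets_refY)
  have "(\<lambda>(y', y). dens M x' y' x y) \<in> borel_measurable (refY M \<Otimes>\<^sub>M \<mu>)"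
    unfolding measurable_cong_sets[OF s refl] case_prod_unfold
    by (intro measurable_dens measurable_const measurable_fst measurable_snd)
       (simp_all add: space_BX x x')
  from P.Fubini'[OF this] show ?thesis
    unfolding dens_X_def pred_dens_def .
qed

lemma measurable_nn_integral_refY:
  assumes "(\<lambda>(p, y'). f p y') \<in> borel_measurable (N \<Otimes>\<^sub>M BY M)"
  shows "(\<lambda>p. \<integral>\<^sup>+ y'. f p y' \<partial>refY M) \<in> borel_measurable N"
proof -
  interpret Y: sigma_finite_measure "refY M" by (rule sigma_finite_refY)
  show ?thesis
    by (rule Y.borel_measurable_nn_integral)
       (simp only: measurable_cong_sets[OF sets_pair_measure_cong[OF refl sets_refY] refl] assms)
qed

lemma measurable_marginal_dens:
  assumes x: "x \<in> N \<rightarrow>\<^sub>M BX M" and \<mu>: "\<mu> \<in> N \<rightarrow>\<^sub>M prob_algebra (BY M)"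
    and x': "x' \<in> N \<rightarrow>\<^sub>M BX M"
  shows "(\<lambda>p. \<integral>\<^sup>+ y. dens_X M (x' p) (x p) y \<partial>\<mu> p) \<in> borel_measurable N"
proof -
  have "(\<lambda>(p, y'). pred_dens (x p) (\<mu> p) (x' p) y') \<in> borel_measurable (N \<Otimes>\<^sub>M BY M)"
    unfolding case_prod_unfold
    by (intro measurable_pred_dens measurable_compose[OF measurable_fst] x \<mu> x' measurable_snd)
  from measurable_nn_integral_refY[OF this]
  have "(\<lambda>p. \<integral>\<^sup>+ y'. pred_dens (x p) (\<mu> p) (x' p) y' \<partial>refY M) \<in> borel_measurable N" .
  moreover have "(\<integral>\<^sup>+ y. dens_X M (x' p) (x p) y \<partial>\<mu> p) =
      (\<integral>\<^sup>+ y'. pred_dens (x p) (\<mu> p) (x' p) y' \<partial>refY M)" if "p \<in> space N" for p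
    using measurable_space[OF x that] measurable_space[OF x' that] measurable_space[OF \<mu> that]
    by (intro nn_integral_dens_X) (simp_all add: space_BX)
  ultimately show ?thesis
    by (subst measurable_cong)
qed

lemma sets_update:
  "sets (update M x x' \<mu>) = sets (BY M)"
  using dflt_prob by (auto simp: update_def Let_def sets_refY space_prob_algebra)

lemma emeasure_update:
  assumes x: "x \<in> spaceX M" and \<mu>: "\<mu> \<in> space (prob_algebra (BY M))" and x': "x' \<in> spaceX M"
    and A: "A \<in> sets (BY M)"
  shows "emeasure (update M x x' \<mu>) A =
    (let d = \<integral>\<^sup>+ y. dens_X M x' x y \<partial>\<mu> in
     if 0 < d \<and> d < \<infinity> then 1 / d * (\<integral>\<^sup>+ y'. pred_dens x \<mu> x' y' * indicator A y' \<partial>refY M)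
     else emeasure (dflt M) A)"
proof -
  have "pred_dens x \<mu> x' \<in> borel_measurable (refY M)"
    unfolding measurable_refY_iff
    by (intro measurable_pred_dens measurable_const) (simp_all add: x x' \<mu> space_BX)
  then show ?thesis
    using A by (simp add: update_def Let_def emeasure_density sets_refY pred_dens_def[symmetric])
qed

lemma prob_space_update:
  assumes x: "x \<in> spaceX M" and \<mu>: "\<mu> \<in> space (prob_algebra (BY M))" and x': "x' \<in> spaceX M"
  shows "prob_space (update M x x' \<mu>)"
proof (rule prob_spaceI)
  let ?d = "\<integral>\<^sup>+ y. dens_X M x' x y \<partial>\<mu>"
  have sp: "space (update M x x' \<mu>) = spaceY M"
    using sets_eq_imp_space_eq[OF sets_update] by (simp add: space_BY)
  have d: "(\<integral>\<^sup>+ y'. pred_dens x \<mu> x' y' * indicator (spaceY M) y' \<partial>refY M) = ?d"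
    unfolding nn_integral_dens_X[OF assms]
    by (intro nn_integral_cong) (simp add: space_refY)
  interpret D: prob_space "dflt M"
    using dflt_prob by (rule prob_algebra_BY)
  have "emeasure (dflt M) (spaceY M) = 1"
    using D.emeasure_space_1 prob_algebra_BY(3)[OF dflt_prob] by simp
  moreover have "1 / ?d * ?d = 1" if "0 < ?d" "?d < \<infinity>"
    using that by (simp add: ennreal_divide_times ennreal_divide_self)
  ultimately show "emeasure (update M x x' \<mu>) (space (update M x x' \<mu>)) = 1"
    unfolding sp using sets.top[of "BY M"] 
    by (subst emeasure_update[OF assms]) (auto simp: space_BY Let_def d)
qed

lemma update_in_prob_algebra:
  assumes "x \<in> spaceX M" "\<mu> \<in> space (prob_algebra (BY M))" "x' \<in> spaceX M"
  shows "update M x x' \<mu> \<in> space (prob_algebra (BY M))"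
  using prob_space_update[OF assms] by (simp add: space_prob_algebra sets_update)

text \<open>
  The case distinction in the updating operator is on a measurable function of the parameter, and on
  each of the two sets the mass given to a fixed set is measurable.
\<close>

lemma measurable_update:
  assumes x: "x \<in> N \<rightarrow>\<^sub>M BX M" and \<mu>: "\<mu> \<in> N \<rightarrow>\<^sub>M prob_algebra (BY M)"
    and x': "x' \<in> N \<rightarrow>\<^sub>M BX M"
  shows "(\<lambda>p. update M (x p) (x' p) (\<mu> p)) \<in> N \<rightarrow>\<^sub>M prob_algebra (BY M)"
proof (rule measurable_prob_algebraI)
  have sp: "x p \<in> spaceX M" "\<mu> p \<in> space (prob_algebra (BY M))" "x' p \<in> spaceX M"
    if "p \<in> space N" for p
    using that measurable_space[OF x] measurable_space[OF \<mu>] measurable_space[OF x']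
    by (simp_all add: space_BX)
  show prob: "prob_space (update M (x p) (x' p) (\<mu> p))" if "p \<in> space N" for p
    using sp[OF that] by (rule prob_space_update)
  show "(\<lambda>p. update M (x p) (x' p) (\<mu> p)) \<in> N \<rightarrow>\<^sub>M subprob_algebra (BY M)"
  proof (rule measurable_subprob_algebra)
    show "subprob_space (update M (x p) (x' p) (\<mu> p))" if "p \<in> space N" for p
      using prob[OF that] by (rule prob_space_imp_subprob_space)
    show "sets (update M (x p) (x' p) (\<mu> p)) = sets (BY M)" for p
      by (rule sets_update)
    fix A assume A: "A \<in> sets (BY M)"
    have [measurable]: "(\<lambda>p. \<integral>\<^sup>+ y. dens_X M (x' p) (x p) y \<partial>\<mu> p) \<in> borel_measurable N"
      by (rule measurable_marginal_dens[OF assms])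
    have "(\<lambda>(p, y'). pred_dens (x p) (\<mu> p) (x' p) y' * indicator A y')
        \<in> borel_measurable (N \<Otimes>\<^sub>M BY M)"
      unfolding case_prod_unfold
      by (intro borel_measurable_times_ennreal measurable_pred_dens measurable_compose[OF measurable_fst]
            x \<mu> x' measurable_snd measurable_compose[OF measurable_snd borel_measurable_indicator[OF A]])
    from measurable_nn_integral_refY[OF this]
    have [measurable]: "(\<lambda>p. \<integral>\<^sup>+ y'. pred_dens (x p) (\<mu> p) (x' p) y' * indicator A y' \<partial>refY M)
        \<in> borel_measurable N" .
    have "(\<lambda>p. let d = \<integral>\<^sup>+ y. dens_X M (x' p) (x p) y \<partial>\<mu> p in
        if 0 < d \<and> d < \<infinity>
        then 1 / d * (\<integral>\<^sup>+ y'. pred_dens (x p) (\<mu> p) (x' p) y' * indicator A y' \<partial>refY M)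
        else emeasure (dflt M) A) \<in> borel_measurable N"
      unfolding Let_def by measurable
    then show "(\<lambda>p. emeasure (update M (x p) (x' p) (\<mu> p)) A) \<in> borel_measurable N"
      by (rule measurable_cong[THEN iffD1, rotated]) (simp only: emeasure_update[OF sp A])
  qed
qed

lemma nn_integral_kernel_X:
  assumes x: "x \<in> spaceX M" and \<mu>: "\<mu> \<in> space (prob_algebra (BY M))"
    and h: "h \<in> borel_measurable (BX M)"
  shows "(\<integral>\<^sup>+ x'. h x' \<partial>kernel_X M x \<mu>) =
    (\<integral>\<^sup>+ x'. (\<integral>\<^sup>+ y. dens_X M x' x y \<partial>\<mu>) * h x' \<partial>refX M)"
proof -
  have "(\<lambda>x'. \<integral>\<^sup>+ y. dens_X M x' x y \<partial>\<mu>) \<in> borel_measurable (refX M)"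
    unfolding measurable_refX_iff
    by (rule measurable_marginal_dens) (simp_all add: x \<mu> space_BX)
  then show ?thesis
    unfolding kernel_X_def by (rule nn_integral_density) (simp only: measurable_refX_iff h)
qed

lemma sets_kernel_X: "sets (kernel_X M x \<mu>) = sets (BX M)"
  by (simp add: kernel_X_def sets_refX)

lemma space_kernel_X: "space (kernel_X M x \<mu>) = spaceX M"
  by (simp add: kernel_X_def space_refX)

lemma total_mass_pred_dens:
  assumes x: "x \<in> spaceX M" and \<mu>: "\<mu> \<in> space (prob_algebra (BY M))"
  shows "(\<integral>\<^sup>+ x'. (\<integral>\<^sup>+ y. dens_X M x' x y \<partial>\<mu>) \<partial>refX M) = 1"
proof -
  interpret \<mu>: prob_space \<mu> using \<mu> by (rule prob_algebra_BY)
  have "(\<integral>\<^sup>+ x'. (\<integral>\<^sup>+ y. dens_X M x' x y \<partial>\<mu>) \<partial>refX M) =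
      (\<integral>\<^sup>+ x'. (\<integral>\<^sup>+ y'. pred_dens x \<mu> x' y' * 1 \<partial>refY M) \<partial>refX M)"
    by (intro nn_integral_cong) (simp add: nn_integral_dens_X[OF x \<mu>] space_refX)
  also have "\<dots> = (\<integral>\<^sup>+ y. (\<integral>\<^sup>+ z'. 1 \<partial>trans_kernel M (x, y)) \<partial>\<mu>)"
    by (rule nn_integral_mixed_kernel[OF x \<mu>, symmetric]) simp
  also have "\<dots> = (\<integral>\<^sup>+ y. 1 \<partial>\<mu>)"
    using x prob_space.emeasure_space_1[OF trans_kernel_prob]
    by (intro nn_integral_cong) (simp add: prob_algebra_BY(3)[OF \<mu>])
  finally show ?thesis by (simp add: \<mu>.emeasure_space_1)
qed

lemma measurable_kernel_X:
  assumes x: "x \<in> N \<rightarrow>\<^sub>M BX M" and \<mu>: "\<mu> \<in> N \<rightarrow>\<^sub>M prob_algebra (BY M)"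
  shows "(\<lambda>p. kernel_X M (x p) (\<mu> p)) \<in> N \<rightarrow>\<^sub>M prob_algebra (BX M)"
proof (rule measurable_prob_algebraI)
  have sp: "x p \<in> spaceX M" "\<mu> p \<in> space (prob_algebra (BY M))" if "p \<in> space N" for p
    using that measurable_space[OF x] measurable_space[OF \<mu>] by (simp_all add: space_BX)
  show prob: "prob_space (kernel_X M (x p) (\<mu> p))" if "p \<in> space N" for p
  proof (rule prob_spaceI)
    have "emeasure (kernel_X M (x p) (\<mu> p)) (space (kernel_X M (x p) (\<mu> p))) =
        (\<integral>\<^sup>+ x'. 1 \<partial>kernel_X M (x p) (\<mu> p))"
      by simp
    also have "\<dots> = 1"
      by (subst nn_integral_kernel_X[OF sp[OF that]]) (simp_all add: total_mass_pred_dens[OF sp[OF that]])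
    finally show "emeasure (kernel_X M (x p) (\<mu> p)) (space (kernel_X M (x p) (\<mu> p))) = 1" .
  qed
  show "(\<lambda>p. kernel_X M (x p) (\<mu> p)) \<in> N \<rightarrow>\<^sub>M subprob_algebra (BX M)"
  proof (rule measurable_subprob_algebra)
    show "subprob_space (kernel_X M (x p) (\<mu> p))" if "p \<in> space N" for p
      using prob[OF that] by (rule prob_space_imp_subprob_space)
    show "sets (kernel_X M (x p) (\<mu> p)) = sets (BX M)" for p
      by (rule sets_kernel_X)
    fix A assume A: "A \<in> sets (BX M)"
    interpret X: sigma_finite_measure "refX M" by (rule sigma_finite_refX)
    have "(\<lambda>(p, x'). (\<integral>\<^sup>+ y. dens_X M x' (x p) y \<partial>\<mu> p) * indicator A x')
        \<in> borel_measurable (N \<Otimes>\<^sub>M BX M)"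
      unfolding case_prod_unfold
      by (intro borel_measurable_times_ennreal measurable_marginal_dens measurable_compose[OF measurable_fst]
            x \<mu> measurable_snd measurable_compose[OF measurable_snd borel_measurable_indicator[OF A]])
    then have "(\<lambda>p. \<integral>\<^sup>+ x'. (\<integral>\<^sup>+ y. dens_X M x' (x p) y \<partial>\<mu> p) * indicator A x' \<partial>refX M)
        \<in> borel_measurable N"
      by (intro X.borel_measurable_nn_integral)
         (simp only: measurable_cong_sets[OF sets_pair_measure_cong[OF refl sets_refX] refl])
    moreover have "emeasure (kernel_X M (x p) (\<mu> p)) A =
        (\<integral>\<^sup>+ x'. (\<integral>\<^sup>+ y. dens_X M x' (x p) y \<partial>\<mu> p) * indicator A x' \<partial>refX M)"
      if "p \<in> space N" for p
    proof -
      have "emeasure (kernel_X M (x p) (\<mu> p)) A = (\<integral>\<^sup>+ x'. indicator A x' \<partial>kernel_X M (x p) (\<mu> p))"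
        using A by (simp add: sets_kernel_X)
      also have "\<dots> = (\<integral>\<^sup>+ x'. (\<integral>\<^sup>+ y. dens_X M x' (x p) y \<partial>\<mu> p) * indicator A x' \<partial>refX M)"
        by (rule nn_integral_kernel_X[OF sp[OF that] borel_measurable_indicator[OF A]])
      finally show ?thesis .
    qed
    ultimately show "(\<lambda>p. emeasure (kernel_X M (x p) (\<mu> p)) A) \<in> borel_measurable N"
      by (subst measurable_cong)
  qed
qed

text \<open>
  Bayes' formula: the law of the next state under belief \<open>\<mu>\<close> is disintegrated into the law of the next
  observation and the updated belief. Multiplying the updated belief by the density of the next
  observation cancels the denominator. Where this density vanishes, the joint density vanishes for
  almost every hidden state, so both integrands are \<open>0\<close> at that observation; and it is infinite only on a null set, because
  its total integral is \<open>1\<close>.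
\<close>

lemma filter_disintegration:
  assumes x: "x \<in> spaceX M" and \<mu>: "\<mu> \<in> space (prob_algebra (BY M))"
    and H: "H \<in> borel_measurable states"
  shows "(\<integral>\<^sup>+ y. (\<integral>\<^sup>+ z'. H z' \<partial>trans_kernel M (x, y)) \<partial>\<mu>) =
    (\<integral>\<^sup>+ x'. (\<integral>\<^sup>+ y'. H (x', y') \<partial>update M x x' \<mu>) \<partial>kernel_X M x \<mu>)"
proof -
  have xB: "x \<in> space (BX M)" using x by (simp add: space_BX)
  let ?d = "\<lambda>x'. \<integral>\<^sup>+ y. dens_X M x' x y \<partial>\<mu>"
  have d: "?d \<in> borel_measurable (refX M)"
    unfolding measurable_refX_iff by (rule measurable_marginal_dens) (simp_all add: xB \<mu>)
  have fin: "AE x' in refX M. ?d x' \<noteq> \<infinity>"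
    by (rule nn_integral_PInf_AE[OF d]) (simp add: total_mass_pred_dens[OF x \<mu>])
  have up: "(\<lambda>x'. \<integral>\<^sup>+ y'. H (x', y') \<partial>update M x x' \<mu>) \<in> borel_measurable (BX M)"
  proof (rule nn_integral_measurable_subprob_algebra2)
    show "(\<lambda>(x', y'). H (x', y')) \<in> borel_measurable states" using H by simp
    show "(\<lambda>x'. update M x x' \<mu>) \<in> BX M \<rightarrow>\<^sub>M subprob_algebra (BY M)"
      by (intro measurable_prob_algebraD measurable_update) (simp_all add: xB \<mu>)
  qed
  have "(\<integral>\<^sup>+ x'. (\<integral>\<^sup>+ y'. H (x', y') \<partial>update M x x' \<mu>) \<partial>kernel_X M x \<mu>) =
      (\<integral>\<^sup>+ x'. ?d x' * (\<integral>\<^sup>+ y'. H (x', y') \<partial>update M x x' \<mu>) \<partial>refX M)"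
    by (rule nn_integral_kernel_X[OF x \<mu> up])
  also have "\<dots> = (\<integral>\<^sup>+ x'. (\<integral>\<^sup>+ y'. pred_dens x \<mu> x' y' * H (x', y') \<partial>refY M) \<partial>refX M)"
  proof (rule nn_integral_cong_AE)
    show "AE x' in refX M. ?d x' * (\<integral>\<^sup>+ y'. H (x', y') \<partial>update M x x' \<mu>) =
        (\<integral>\<^sup>+ y'. pred_dens x \<mu> x' y' * H (x', y') \<partial>refY M)"
      using fin AE_space
    proof eventually_elim
      case (elim x')
      then have x': "x' \<in> spaceX M" "x' \<in> space (BX M)"
        by (simp_all add: space_refX space_BX)
      have pd: "pred_dens x \<mu> x' \<in> borel_measurable (refY M)"
        unfolding measurable_refY_iff by (rule measurable_pred_dens) (simp_all add: x' xB \<mu>)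
      have Hx': "(\<lambda>y'. H (x', y')) \<in> borel_measurable (refY M)"
        unfolding measurable_refY_iff using measurable_Pair2[OF H x'(2)] .
      show ?case
      proof (cases "?d x' = 0")
        case True
        then have "AE y' in refY M. pred_dens x \<mu> x' y' = 0"
          unfolding nn_integral_dens_X[OF x \<mu> x'(1)] using pd by (simp add: nn_integral_0_iff_AE)
        then have "(\<integral>\<^sup>+ y'. pred_dens x \<mu> x' y' * H (x', y') \<partial>refY M) = (\<integral>\<^sup>+ y'. 0 \<partial>refY M)"
          by (intro nn_integral_cong_AE) auto
        with True show ?thesis by simp
      next
        case False
        then have pos: "0 < ?d x'" "?d x' < \<infinity>"
          using elim by (auto simp: less_top zero_less_iff_neq_zero)
        have "(\<integral>\<^sup>+ y'. H (x', y') \<partial>update M x x' \<mu>) =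
            1 / ?d x' * (\<integral>\<^sup>+ y'. pred_dens x \<mu> x' y' * H (x', y') \<partial>refY M)"
          using pos pd Hx'
          by (simp add: update_def pred_dens_def[symmetric] nn_integral_scale_measure
              nn_integral_density)
        then have "?d x' * (\<integral>\<^sup>+ y'. H (x', y') \<partial>update M x x' \<mu>) =
            (?d x' * (1 / ?d x')) * (\<integral>\<^sup>+ y'. pred_dens x \<mu> x' y' * H (x', y') \<partial>refY M)"
          by (simp add: mult.assoc)
        also have "?d x' * (1 / ?d x') = 1"
          using pos by (simp add: ennreal_times_divide ennreal_divide_self)
        finally show ?thesis by simp
      qed
    qed
  qed
  also have "\<dots> = (\<integral>\<^sup>+ y. (\<integral>\<^sup>+ z'. H z' \<partial>trans_kernel M (x, y)) \<partial>\<mu>)"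
    by (rule nn_integral_mixed_kernel[OF assms, symmetric])
  finally show ?thesis ..
qed

section \<open>Values of stopping times\<close>

definition policy_value :: "((nat \<Rightarrow> 'x \<times> 'y) \<Rightarrow> nat) \<Rightarrow> 'x \<Rightarrow> 'y measure \<Rightarrow> real \<Rightarrow> ereal" where
  "policy_value \<tau> x \<mu> s =
     ext_integral \<mu> (\<lambda>y. ext_integral (law M x y) (\<lambda>\<omega>. ereal (utility M s \<tau> \<omega>)))"

text \<open>
  The expected positive part \<open>\<E>\<^sub>x\<^sub>y [f\<^sup>+]\<close>, as \<open>ennreal\<close> truncates at zero.
\<close>

definition pos_mean :: "((nat \<Rightarrow> 'x \<times> 'y) \<Rightarrow> real) \<Rightarrow> 'x \<Rightarrow> 'y \<Rightarrow> ennreal" where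
  "pos_mean f x y = (\<integral>\<^sup>+ \<omega>. ennreal (f \<omega>) \<partial>law M x y)"

lemma V_eq_SUP: "V M n x \<mu> s = (SUP \<tau>\<in>stopping_times M n. policy_value \<tau> x \<mu> s)"
  unfolding V_def policy_value_def ..

lemma ext_integral_utility:
  "ext_integral (law M x y) (\<lambda>\<omega>. ereal (f \<omega>)) =
    enn2ereal (pos_mean f x y) - enn2ereal (pos_mean (\<lambda>\<omega>. - f \<omega>) x y)"
  by (simp add: ext_integral_def pos_mean_def)

lemma measurable_pos_mean:
  assumes f: "f \<in> borel_measurable paths"
  shows "(\<lambda>z. pos_mean f (fst z) (snd z)) \<in> borel_measurable states"
  unfolding pos_mean_def
proof (rule nn_integral_measurable_subprob_algebra2[OF _ measurable_path_law_subprob])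
  show "(\<lambda>(z, \<omega>). ennreal (f \<omega>)) \<in> borel_measurable (states \<Otimes>\<^sub>M paths)"
    unfolding case_prod_unfold
    by (rule measurable_compose[OF measurable_compose[OF measurable_snd f] measurable_ennreal])
qed

lemma measurable_pos_mean_snd:
  assumes f: "f \<in> borel_measurable paths" and x: "x \<in> spaceX M"
    and \<mu>: "sets \<mu> = sets (BY M)"
  shows "pos_mean f x \<in> borel_measurable \<mu>"
  using measurable_Pair2[OF measurable_pos_mean[OF f], of x] x
  unfolding measurable_cong_sets[OF \<mu> refl] by (simp add: space_BX)

lemma pos_mean_markov:
  assumes x: "x \<in> spaceX M" and y: "y \<in> spaceY M" and f: "f \<in> borel_measurable paths"
    and eq: "\<And>\<omega>. \<omega> \<in> space paths \<Longrightarrow> f (case_nat (x, y) \<omega>) = f' \<omega>"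
  shows "pos_mean f x y = (\<integral>\<^sup>+ z. pos_mean f' (fst z) (snd z) \<partial>trans_kernel M (x, y))"
proof -
  have z: "(x, y) \<in> space states" using x y by (simp add: space_states)
  have "pos_mean f x y =
      (\<integral>\<^sup>+ z. (\<integral>\<^sup>+ \<omega>. ennreal (f (case_nat (x, y) \<omega>)) \<partial>path_law z) \<partial>trans_kernel M (x, y))"
    using nn_integral_path_law[OF z measurable_compose[OF f measurable_ennreal]]
    by (simp add: pos_mean_def)
  also have "\<dots> = (\<integral>\<^sup>+ z. pos_mean f' (fst z) (snd z) \<partial>trans_kernel M (x, y))"
    unfolding pos_mean_def by (intro nn_integral_cong) (simp add: space_trans_kernel[OF z] eq)
  finally show ?thesis .
qed

lemma policy_value_stop:
  assumes \<tau>: "\<tau> \<in> stopping_times M n" and x: "x \<in> spaceX M"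
    and \<mu>: "\<mu> \<in> space (prob_algebra (BY M))"
    and stop: "\<And>y \<omega>. y \<in> spaceY M \<Longrightarrow> \<omega> \<in> space paths \<Longrightarrow> \<tau> (case_nat (x, y) \<omega>) = 0"
  shows "policy_value \<tau> x \<mu> s = ereal (util M (gain M x + s))"
proof -
  let ?u = "util M (gain M x + s)"
  interpret \<mu>: prob_space \<mu> using \<mu> by (rule prob_algebra_BY)
  have minus: "enn2ereal (ennreal r) - enn2ereal (ennreal (- r)) = ereal r" for r
    by (cases "0 \<le> r") (simp_all add: ennreal_neg zero_ennreal.rep_eq)
  have const: "pos_mean f x y = ennreal r"
    if y: "y \<in> spaceY M" and f: "f \<in> borel_measurable paths"
      and eq: "\<And>\<omega>. \<omega> \<in> space paths \<Longrightarrow> f (case_nat (x, y) \<omega>) = r" for f r y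
  proof -
    have z: "(x, y) \<in> space states" using x y by (simp add: space_states)
    interpret K: prob_space "trans_kernel M (x, y)"
      using x y by (intro trans_kernel_prob) simp
    have "pos_mean f x y = (\<integral>\<^sup>+ z. pos_mean (\<lambda>_. r) (fst z) (snd z) \<partial>trans_kernel M (x, y))"
      by (rule pos_mean_markov[OF x y f eq])
    also have "\<dots> = (\<integral>\<^sup>+ z. ennreal r \<partial>trans_kernel M (x, y))"
      using prob_space.emeasure_space_1[OF prob_space_path_law]
      by (intro nn_integral_cong) (simp add: pos_mean_def space_trans_kernel[OF z])
    finally show ?thesis by (simp add: K.emeasure_space_1)
  qed
  have m: "utility M s \<tau> \<in> borel_measurable paths" by (rule measurable_utility[OF \<tau>])
  have "policy_value \<tau> x \<mu> s = ext_integral \<mu> (\<lambda>y. ereal ?u)"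
    unfolding policy_value_def
  proof (rule ext_integral_cong)
    fix y assume "y \<in> space \<mu>"
    then have y: "y \<in> spaceY M" by (simp add: prob_algebra_BY(3)[OF \<mu>])
    have "utility M s \<tau> (case_nat (x, y) \<omega>) = ?u" if "\<omega> \<in> space paths" for \<omega>
      using utility_0[of \<tau> "(x, y)" \<omega> s] stop[OF y that] by simp
    then have "pos_mean (utility M s \<tau>) x y = ennreal ?u"
      "pos_mean (\<lambda>\<omega>. - utility M s \<tau> \<omega>) x y = ennreal (- ?u)"
      using m by (intro const[OF y]; simp)+
    then show "ext_integral (law M x y) (\<lambda>\<omega>. ereal (utility M s \<tau> \<omega>)) = ereal ?u"
      unfolding ext_integral_utility by (simp only: minus)
  qed
  also have "\<dots> = ereal ?u"
    by (simp add: ext_integral_def \<mu>.emeasure_space_1 minus)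
  finally show ?thesis .
qed

lemma V_0:
  assumes x: "x \<in> spaceX M" and \<mu>: "\<mu> \<in> space (prob_algebra (BY M))"
  shows "V M 0 x \<mu> s = ereal (util M (gain M x + s))"
proof -
  have "policy_value \<tau> x \<mu> s = ereal (util M (gain M x + s))" if \<tau>: "\<tau> \<in> stopping_times M 0" for \<tau>
    using stopping_timesD(2)[OF \<tau> case_nat_in_paths] x
    by (intro policy_value_stop[OF \<tau> x \<mu>]) (simp add: space_states)
  then show ?thesis
    using zero_stopping_time[of 0] unfolding V_eq_SUP by (intro antisym SUP_least SUP_upper2) auto
qed

text \<open>
  For \<open>a > 0\<close>, the slope of the concave function \<open>U\<close> between \<open>0\<close> and \<open>a\<close> is at most its slope between
  \<open>-1\<close> and \<open>0\<close>.
\<close>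

lemma util_affine_bound:
  "util M a \<le> \<bar>util M 0\<bar> + (util M 0 - util M (- 1)) * max a 0"
proof (cases "a \<le> 0")
  case True
  then have "util M a \<le> util M 0"
    by (rule monoD[OF strict_mono_mono[OF util_strict_mono]])
  then show ?thesis using True by (simp add: max_def)
next
  case False
  \<comment> \<open>This \<open>t\<close> represents \<open>0\<close> as a convex combination of \<open>-1\<close> and \<open>a\<close>.\<close>
  define t where "t = 1 / (1 + a)"
  have t: "0 \<le> t" "t \<le> 1" "(1 - t) * (- 1) + t * a = 0"
    using False by (auto simp: t_def field_simps)
  have "(1 - t) * util M (- 1) + t * util M a \<le> util M ((1 - t) * (- 1) + t * a)"
    using concave_onD[OF util_concave t(1,2), of "- 1" a] by simp
  then have "(1 - t) * util M (- 1) + t * util M a \<le> util M 0"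
    unfolding t(3) .
  then have "((1 - t) * util M (- 1) + t * util M a) * (1 + a) \<le> util M 0 * (1 + a)"
    using False by (intro mult_right_mono) auto
  moreover have "((1 - t) * util M (- 1) + t * util M a) * (1 + a) = a * util M (- 1) + util M a"
  proof -
    have "t * (1 + a) = 1" "(1 - t) * (1 + a) = a"
      using False by (simp_all add: t_def field_simps)
    moreover have "((1 - t) * util M (- 1) + t * util M a) * (1 + a) =
        ((1 - t) * (1 + a)) * util M (- 1) + (t * (1 + a)) * util M a"
      by (simp add: algebra_simps)
    ultimately show ?thesis by simp
  qed
  ultimately have "util M a \<le> util M 0 + (util M 0 - util M (- 1)) * a"
    by (simp add: algebra_simps)
  then show ?thesis using False by (simp add: max_def)
qed

end

locale integrable_stopping_problem = stopping_problem M
  for M :: "('x::polish_space, 'y::polish_space) stopping_model" +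
  fixes N :: nat
  assumes bounded_payoff: "\<forall>x\<in>spaceX M. (SUP \<tau>\<in>stopping_times M N. SUP y\<in>spaceY M.
           \<integral>\<^sup>+ \<omega>. ennreal ((\<Sum>k<\<tau> \<omega>. max (cost M (fst (\<omega> k))) 0)
                            + max (gain M (fst (\<omega> (\<tau> \<omega>)))) 0) \<partial>law M x y) < \<infinity>"
begin

text \<open>
  The bound is uniform in the hidden state \<open>y\<close>, and hence it survives averaging over an arbitrary
  belief.
\<close>

lemma pos_mean_utility_bounded:
  assumes x: "x \<in> spaceX M"
  obtains C where "C < \<infinity>"
    and "\<And>\<tau> y. \<tau> \<in> stopping_times M N \<Longrightarrow> y \<in> spaceY M \<Longrightarrow> pos_mean (utility M s \<tau>) x y \<le> C"
proof
  define K where "K = util M 0 - util M (- 1)"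
  have K: "0 \<le> K"
    using strict_monoD[OF util_strict_mono, of "- 1" 0] by (simp add: K_def)
  define W where "W \<tau> \<omega> = (\<Sum>k<\<tau> \<omega>. max (cost M (fst (\<omega> k))) 0) + max (gain M (fst (\<omega> (\<tau> \<omega>)))) 0"
    for \<tau> :: "(nat \<Rightarrow> 'x \<times> 'y) \<Rightarrow> nat" and \<omega>
  define S where "S = (SUP \<tau>\<in>stopping_times M N. SUP y\<in>spaceY M. \<integral>\<^sup>+ \<omega>. ennreal (W \<tau> \<omega>) \<partial>law M x y)"
  have S: "S < \<infinity>"
    using bounded_payoff x unfolding S_def W_def by blast
  define c where "c = \<bar>util M 0\<bar> + K * \<bar>s\<bar>"
  have c: "0 \<le> c" using K by (simp add: c_def)
  show "ennreal c + ennreal K * S < \<infinity>"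
    using S by (simp add: ennreal_mult_less_top)
  fix \<tau> y assume \<tau>: "\<tau> \<in> stopping_times M N" and y: "y \<in> spaceY M"
  have z: "(x, y) \<in> space states" using x y by (simp add: space_states)
  interpret P: prob_space "law M x y"
    using prob_space_path_law[OF z] by simp
  have W: "0 \<le> W \<tau> \<omega>" for \<omega>
    unfolding W_def by (intro add_nonneg_nonneg sum_nonneg) auto
  have mW: "W \<tau> \<in> borel_measurable (law M x y)"
  proof -
    have \<tau>m: "\<tau> \<in> paths \<rightarrow>\<^sub>M count_space UNIV"
      by (rule measurable_stopping_times[OF \<tau>])
    have "(\<lambda>\<omega>. (\<lambda>t \<omega>. (\<Sum>k<t. max (cost M (fst (\<omega> k))) 0) + max (gain M (fst (\<omega> t))) 0) (\<tau> \<omega>) \<omega>)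
        \<in> borel_measurable paths"
      by (rule measurable_compose_countable[OF _ \<tau>m]) measurable
    then have "W \<tau> \<in> borel_measurable paths" unfolding W_def .
    then show ?thesis
      using measurable_path_law_iff[OF z] unfolding fst_conv snd_conv by blast
  qed
  have "pos_mean (utility M s \<tau>) x y \<le> (\<integral>\<^sup>+ \<omega>. ennreal c + ennreal K * ennreal (W \<tau> \<omega>) \<partial>law M x y)"
    unfolding pos_mean_def
  proof (rule nn_integral_mono)
    fix \<omega>
    define a where "a = (\<Sum>k<\<tau> \<omega>. cost M (fst (\<omega> k))) + s + gain M (fst (\<omega> (\<tau> \<omega>)))"
    have "(\<Sum>k<\<tau> \<omega>. cost M (fst (\<omega> k))) \<le> (\<Sum>k<\<tau> \<omega>. max (cost M (fst (\<omega> k))) 0)"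
      by (intro sum_mono) simp
    then have "a \<le> \<bar>s\<bar> + W \<tau> \<omega>"
      unfolding a_def W_def by linarith
    with W[of \<omega>] have "max a 0 \<le> \<bar>s\<bar> + W \<tau> \<omega>"
      by simp
    then have "K * max a 0 \<le> K * (\<bar>s\<bar> + W \<tau> \<omega>)"
      using K by (rule mult_left_mono)
    moreover have "utility M s \<tau> \<omega> = util M a"
      by (simp add: utility_def a_def)
    ultimately have "utility M s \<tau> \<omega> \<le> c + K * W \<tau> \<omega>"
      using util_affine_bound[of a] unfolding c_def K_def[symmetric] distrib_left by linarith
    then have "ennreal (utility M s \<tau> \<omega>) \<le> ennreal (c + K * W \<tau> \<omega>)"
      by (rule ennreal_leI)
    also have "\<dots> = ennreal c + ennreal K * ennreal (W \<tau> \<omega>)"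
      using c K W[of \<omega>] by (simp add: ennreal_plus ennreal_mult)
    finally show "ennreal (utility M s \<tau> \<omega>) \<le> ennreal c + ennreal K * ennreal (W \<tau> \<omega>)" .
  qed
  also have "\<dots> = ennreal c + ennreal K * (\<integral>\<^sup>+ \<omega>. ennreal (W \<tau> \<omega>) \<partial>law M x y)"
    using mW by (simp add: nn_integral_add nn_integral_cmult P.emeasure_space_1)
  also have "\<dots> \<le> ennreal c + ennreal K * S"
    unfolding S_def using \<tau> y by (intro add_left_mono mult_left_mono SUP_upper2 order_refl) auto
  finally show "pos_mean (utility M s \<tau>) x y \<le> ennreal c + ennreal K * S" .
qed

lemma pos_mean_utility_finite:
  assumes x: "x \<in> spaceX M" and \<mu>: "\<mu> \<in> space (prob_algebra (BY M))"
    and \<tau>: "\<tau> \<in> stopping_times M N"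
  shows "(\<integral>\<^sup>+ y. pos_mean (utility M s \<tau>) x y \<partial>\<mu>) < \<infinity>"
proof -
  interpret \<mu>: prob_space \<mu> using \<mu> by (rule prob_algebra_BY)
  obtain C where C: "C < \<infinity>"
    and le: "\<And>\<tau> y. \<tau> \<in> stopping_times M N \<Longrightarrow> y \<in> spaceY M \<Longrightarrow> pos_mean (utility M s \<tau>) x y \<le> C"
    using pos_mean_utility_bounded[OF x, of s] by blast
  have "(\<integral>\<^sup>+ y. pos_mean (utility M s \<tau>) x y \<partial>\<mu>) \<le> (\<integral>\<^sup>+ y. C \<partial>\<mu>)"
    using le[OF \<tau>] by (intro nn_integral_mono) (simp add: prob_algebra_BY(3)[OF \<mu>])
  also have "\<dots> < \<infinity>" using C by (simp add: \<mu>.emeasure_space_1)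
  finally show ?thesis .
qed

lemma policy_value_eq:
  assumes x: "x \<in> spaceX M" and \<mu>: "\<mu> \<in> space (prob_algebra (BY M))"
    and \<tau>: "\<tau> \<in> stopping_times M N"
  shows "policy_value \<tau> x \<mu> s = enn2ereal (\<integral>\<^sup>+ y. pos_mean (utility M s \<tau>) x y \<partial>\<mu>)
    - enn2ereal (\<integral>\<^sup>+ y. pos_mean (\<lambda>\<omega>. - utility M s \<tau> \<omega>) x y \<partial>\<mu>)"
  unfolding policy_value_def ext_integral_utility
  using measurable_utility[OF \<tau>] prob_algebra_BY(2)[OF \<mu>]
  by (intro ext_integral_diff pos_mean_utility_finite assms measurable_pos_mean_snd x) auto

text \<open>
  The dynamic programming identity for a single stopping time. It is proved for the positive and the
  negative part of the utility separately, since the Markov property and Bayes' formula are identities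
  between integrals of nonnegative functions.
\<close>

lemma policy_value_continue:
  assumes x: "x \<in> spaceX M" and \<mu>: "\<mu> \<in> space (prob_algebra (BY M))"
    and \<tau>: "\<tau> \<in> stopping_times M N" and \<tau>': "\<tau>' \<in> stopping_times M N"
    and shift: "\<And>y \<omega>. y \<in> spaceY M \<Longrightarrow> \<omega> \<in> space paths \<Longrightarrow> \<tau> (case_nat (x, y) \<omega>) = Suc (\<tau>' \<omega>)"
  shows "policy_value \<tau> x \<mu> s = ext_integral (kernel_X M x \<mu>)
    (\<lambda>x'. policy_value \<tau>' x' (update M x x' \<mu>) (s + cost M x))"
proof -
  let ?u = "utility M s \<tau>" and ?u' = "utility M (s + cost M x) \<tau>'"
  have m: "?u \<in> borel_measurable paths" and m': "?u' \<in> borel_measurable paths"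
    by (rule measurable_utility[OF \<tau>] measurable_utility[OF \<tau>'])+
  have next_mean: "(\<integral>\<^sup>+ y. pos_mean f x y \<partial>\<mu>) =
      (\<integral>\<^sup>+ x'. (\<integral>\<^sup>+ y'. pos_mean f' x' y' \<partial>update M x x' \<mu>) \<partial>kernel_X M x \<mu>)"
    if f: "f \<in> borel_measurable paths" and f': "f' \<in> borel_measurable paths"
      and eq: "\<And>y \<omega>. y \<in> spaceY M \<Longrightarrow> \<omega> \<in> space paths \<Longrightarrow> f (case_nat (x, y) \<omega>) = f' \<omega>" for f f'
  proof -
    have "(\<integral>\<^sup>+ y. pos_mean f x y \<partial>\<mu>) =
        (\<integral>\<^sup>+ y. (\<integral>\<^sup>+ z. pos_mean f' (fst z) (snd z) \<partial>trans_kernel M (x, y)) \<partial>\<mu>)"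
      using eq by (intro nn_integral_cong pos_mean_markov[OF x _ f]) (simp_all add: prob_algebra_BY(3)[OF \<mu>])
    also have "\<dots> = (\<integral>\<^sup>+ x'. (\<integral>\<^sup>+ y'. pos_mean f' x' y' \<partial>update M x x' \<mu>) \<partial>kernel_X M x \<mu>)"
      using filter_disintegration[OF x \<mu> measurable_pos_mean[OF f']] by simp
    finally show ?thesis .
  qed
  have eq: "?u (case_nat (x, y) \<omega>) = ?u' \<omega>" if "y \<in> spaceY M" "\<omega> \<in> space paths" for y \<omega>
    using utility_Suc[of \<tau> "(x, y)" \<omega> \<tau>' s] shift[OF that] by simp
  have pos: "(\<integral>\<^sup>+ y. pos_mean ?u x y \<partial>\<mu>) =
      (\<integral>\<^sup>+ x'. (\<integral>\<^sup>+ y'. pos_mean ?u' x' y' \<partial>update M x x' \<mu>) \<partial>kernel_X M x \<mu>)"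
    by (rule next_mean[OF m m' eq])
  have neg: "(\<integral>\<^sup>+ y. pos_mean (\<lambda>\<omega>. - ?u \<omega>) x y \<partial>\<mu>) =
      (\<integral>\<^sup>+ x'. (\<integral>\<^sup>+ y'. pos_mean (\<lambda>\<omega>. - ?u' \<omega>) x' y' \<partial>update M x x' \<mu>) \<partial>kernel_X M x \<mu>)"
    using m m' eq by (intro next_mean) auto
  have meas: "(\<lambda>x'. \<integral>\<^sup>+ y'. pos_mean f x' y' \<partial>update M x x' \<mu>) \<in> borel_measurable (kernel_X M x \<mu>)"
    if f: "f \<in> borel_measurable paths" for f
    unfolding measurable_cong_sets[OF sets_kernel_X refl]
  proof (rule nn_integral_measurable_subprob_algebra2)
    show "(\<lambda>(x', y'). pos_mean f x' y') \<in> borel_measurable states"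
      using measurable_pos_mean[OF f] by (simp add: case_prod_unfold)
    show "(\<lambda>x'. update M x x' \<mu>) \<in> BX M \<rightarrow>\<^sub>M subprob_algebra (BY M)"
      by (intro measurable_prob_algebraD measurable_update) (simp_all add: x \<mu> space_BX)
  qed
  have "ext_integral (kernel_X M x \<mu>) (\<lambda>x'. policy_value \<tau>' x' (update M x x' \<mu>) (s + cost M x)) =
      ext_integral (kernel_X M x \<mu>) (\<lambda>x'. enn2ereal (\<integral>\<^sup>+ y'. pos_mean ?u' x' y' \<partial>update M x x' \<mu>)
        - enn2ereal (\<integral>\<^sup>+ y'. pos_mean (\<lambda>\<omega>. - ?u' \<omega>) x' y' \<partial>update M x x' \<mu>))"
    by (intro ext_integral_cong policy_value_eq \<tau>' update_in_prob_algebra x \<mu>)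
       (simp_all add: space_kernel_X)
  also have "\<dots> = enn2ereal (\<integral>\<^sup>+ y. pos_mean ?u x y \<partial>\<mu>) - enn2ereal (\<integral>\<^sup>+ y. pos_mean (\<lambda>\<omega>. - ?u \<omega>) x y \<partial>\<mu>)"
    unfolding pos neg
  proof (rule ext_integral_diff)
    show "(\<integral>\<^sup>+ x'. (\<integral>\<^sup>+ y'. pos_mean ?u' x' y' \<partial>update M x x' \<mu>) \<partial>kernel_X M x \<mu>) < \<infinity>"
      using pos_mean_utility_finite[OF x \<mu> \<tau>, of s] unfolding pos .
  qed (use m' in \<open>intro meas; simp\<close>)+
  also have "\<dots> = policy_value \<tau> x \<mu> s"
    by (rule policy_value_eq[OF x \<mu> \<tau>, symmetric])
  finally show ?thesis ..
qed

lemma objective_eq: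
  assumes x: "x \<in> spaceX M" and \<tau>: "\<tau> \<in> stopping_times M N"
  shows "objective M x \<tau> = policy_value \<tau> x (init M) 0"
proof -
  have "(\<lambda>y. law M x y) \<in> BY M \<rightarrow>\<^sub>M subprob_algebra paths"
    using measurable_Pair2[OF measurable_path_law_subprob, of x] x by (simp add: space_BX)
  then have law: "law M x \<in> init M \<rightarrow>\<^sub>M subprob_algebra paths"
    unfolding measurable_cong_sets[OF prob_algebra_BY(2)[OF init_prob] refl] .
  have "(\<integral>\<^sup>+ \<omega>. ennreal (f \<omega>) \<partial>law_init M x) = (\<integral>\<^sup>+ y. pos_mean f x y \<partial>init M)"
    if "f \<in> borel_measurable paths" for f
    unfolding law_init_def pos_mean_def
    by (rule nn_integral_bind[OF measurable_compose[OF that measurable_ennreal] law])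
  then show ?thesis
    unfolding policy_value_eq[OF x init_prob \<tau>]
    using measurable_utility[OF \<tau>, of 0] by (simp add: objective_def ext_integral_def)
qed

end

section \<open>Dynamic programming\<close>

context stopping_problem
begin

lemma f_star_eq_1_iff:
  "f_star M n x \<mu> s = 1 \<longleftrightarrow> continuation M n x \<mu> s \<le> ereal (util M (gain M x + s))"
  by (simp add: f_star_def flip: max.absorb_iff1)

text \<open>
  Suprema over uncountably many stopping times need not be measurable, so this is carried along in the
  induction and obtained from the recursion.
\<close>

definition V_measurable :: "nat \<Rightarrow> bool" where
  "V_measurable n \<longleftrightarrow> (\<lambda>(x, \<mu>, s). V M n x \<mu> s)
     \<in> borel_measurable (BX M \<Otimes>\<^sub>M (prob_algebra (BY M) \<Otimes>\<^sub>M borel))"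

lemma V_measurable_compose:
  assumes V: "V_measurable n" and x: "x \<in> A \<rightarrow>\<^sub>M BX M"
    and \<mu>: "\<mu> \<in> A \<rightarrow>\<^sub>M prob_algebra (BY M)" and s: "s \<in> borel_measurable A"
  shows "(\<lambda>p. V M n (x p) (\<mu> p) (s p)) \<in> borel_measurable A"
  using measurable_compose[OF measurable_Pair[OF x measurable_Pair[OF \<mu> s]] V[unfolded V_measurable_def]]
  by simp

lemma measurable_reward:
  assumes x: "x \<in> A \<rightarrow>\<^sub>M BX M" and s: "s \<in> borel_measurable A"
  shows "(\<lambda>p. ereal (util M (gain M (x p) + s p))) \<in> borel_measurable A"
  by (intro borel_measurable_ereal measurable_compose[OF _ measurable_util] borel_measurable_add s
        measurable_compose[OF x measurable_gain])

lemma measurable_continuation: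
  assumes V: "V_measurable n" and x: "x \<in> A \<rightarrow>\<^sub>M BX M"
    and \<mu>: "\<mu> \<in> A \<rightarrow>\<^sub>M prob_algebra (BY M)" and s: "s \<in> borel_measurable A"
  shows "(\<lambda>p. continuation M (Suc n) (x p) (\<mu> p) (s p)) \<in> borel_measurable A"
  unfolding continuation_def diff_Suc_1
proof (rule measurable_ext_integral)
  show "(\<lambda>p. kernel_X M (x p) (\<mu> p)) \<in> A \<rightarrow>\<^sub>M subprob_algebra (BX M)"
    by (intro measurable_prob_algebraD measurable_kernel_X x \<mu>)
  have x1: "(\<lambda>p. x (fst p)) \<in> A \<Otimes>\<^sub>M BX M \<rightarrow>\<^sub>M BX M"
    and \<mu>1: "(\<lambda>p. \<mu> (fst p)) \<in> A \<Otimes>\<^sub>M BX M \<rightarrow>\<^sub>M prob_algebra (BY M)"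
    and s1: "(\<lambda>p. s (fst p)) \<in> borel_measurable (A \<Otimes>\<^sub>M BX M)"
    by (rule measurable_compose[OF measurable_fst] x \<mu> s)+
  show "(\<lambda>(p, x'). V M n x' (update M (x p) x' (\<mu> p)) (s p + cost M (x p)))
      \<in> borel_measurable (A \<Otimes>\<^sub>M BX M)"
    unfolding case_prod_unfold
    by (intro V_measurable_compose[OF V] measurable_snd measurable_update x1 \<mu>1
          borel_measurable_add s1 measurable_compose[OF x1 measurable_cost])
qed

lemma measurable_stop_event:
  assumes V: "V_measurable n" and x: "x \<in> A \<rightarrow>\<^sub>M BX M"
    and \<mu>: "\<mu> \<in> A \<rightarrow>\<^sub>M prob_algebra (BY M)" and s: "s \<in> borel_measurable A"
  shows "{p \<in> space A. f_star M (Suc n) (x p) (\<mu> p) (s p) = 1} \<in> sets A"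
  unfolding f_star_eq_1_iff
  by (rule borel_measurable_le[OF measurable_continuation[OF assms] measurable_reward[OF x s]])

text \<open>
  The filter with initial belief \<open>m (h 0)\<close>. A belief that depends on the first observation is what
  remains after one step: a belief \<open>\<mu>\<close> at \<open>x\<close> becomes \<open>\<lambda>x'. update M x x' \<mu>\<close>. This generality makes
  the class of rules below closed under shifting time.
\<close>

primrec filter_from :: "('x \<Rightarrow> 'y measure) \<Rightarrow> nat \<Rightarrow> (nat \<Rightarrow> 'x) \<Rightarrow> 'y measure" where
  "filter_from m 0 h = m (h 0)"
| "filter_from m (Suc n) h = update M (h n) (h (Suc n)) (filter_from m n h)"

text \<open>
  The first time at which stopping attains the maximum in the recursion, capped at the horizon \<open>n\<close>, in
  the problem with initial belief \<open>m\<close> and accumulated cost \<open>s\<close>.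
\<close>

definition stop_rule :: "nat \<Rightarrow> ('x \<Rightarrow> 'y measure) \<Rightarrow> real \<Rightarrow> (nat \<Rightarrow> 'x \<times> 'y) \<Rightarrow> nat" where
  "stop_rule n m s \<omega> = Min ({k. k < n \<and> f_star M (n - k) (fst (\<omega> k))
      (filter_from m k (\<lambda>j. fst (\<omega> j))) (s + (\<Sum>j<k. cost M (fst (\<omega> j)))) = 1} \<union> {n})"

lemma filter_from_const: "filter_from (\<lambda>_. init M) n h = filter_dist M n h"
  by (induction n) simp_all

lemma tau_star_eq: "tau_star M n = stop_rule n (\<lambda>_. init M) 0"
  by (simp add: fun_eq_iff tau_star_def stop_rule_def g_star_def filter_from_const)

lemma filter_from_shift:
  "filter_from m (Suc n) (case_nat x h) = filter_from (\<lambda>x'. update M x x' (m x)) n h"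
proof (induction n)
  case (Suc n)
  then show ?case by (subst filter_from.simps) (simp del: filter_from.simps(2), simp)
qed simp

lemma stop_rule_stop:
  assumes "f_star M (Suc n) (fst z) (m (fst z)) s = 1"
  shows "stop_rule (Suc n) m s (case_nat z \<omega>) = 0"
proof -
  have "stop_rule (Suc n) m s (case_nat z \<omega>) \<le> 0"
    unfolding stop_rule_def using assms by (intro Min_le) auto
  then show ?thesis by simp
qed

text \<open>
  After a first step without stopping, the rule is the rule of the same kind for the remaining
  problem.
\<close>

lemma stop_rule_continue:
  assumes "f_star M (Suc n) (fst z) (m (fst z)) s \<noteq> 1"
  shows "stop_rule (Suc n) m s (case_nat z \<omega>) =
    Suc (stop_rule n (\<lambda>x'. update M (fst z) x' (m (fst z))) (s + cost M (fst z)) \<omega>)"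
proof -
  let ?m = "\<lambda>x'. update M (fst z) x' (m (fst z))" and ?s = "s + cost M (fst z)"
  let ?P = "\<lambda>k. f_star M (Suc n - k) (fst (case_nat z \<omega> k))
      (filter_from m k (\<lambda>j. fst (case_nat z \<omega> j))) (s + (\<Sum>j<k. cost M (fst (case_nat z \<omega> j)))) = 1"
  let ?P' = "\<lambda>k. f_star M (n - k) (fst (\<omega> k))
      (filter_from ?m k (\<lambda>j. fst (\<omega> j))) (?s + (\<Sum>j<k. cost M (fst (\<omega> j)))) = 1"
  have h: "(\<lambda>j. fst (case_nat z \<omega> j)) = case_nat (fst z) (\<lambda>j. fst (\<omega> j))"
    by (auto simp: fun_eq_iff split: nat.split)
  have 0: "\<not> ?P 0" using assms by simp
  have S: "?P (Suc k) \<longleftrightarrow> ?P' k" for k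
    unfolding h filter_from_shift
    by (simp add: sum.lessThan_Suc_shift add.assoc del: sum.lessThan_Suc filter_from.simps)
  have "{k. k < Suc n \<and> ?P k} \<union> {Suc n} = Suc ` ({k. k < n \<and> ?P' k} \<union> {n})"
  proof (rule set_eqI)
    fix k
    show "k \<in> {k. k < Suc n \<and> ?P k} \<union> {Suc n} \<longleftrightarrow> k \<in> Suc ` ({k. k < n \<and> ?P' k} \<union> {n})"
    proof (cases k)
      case 0
      then show ?thesis using \<open>\<not> ?P 0\<close> by auto
    next
      case (Suc j)
      show ?thesis unfolding Suc using S[of j] by (simp add: inj_image_mem_iff)
    qed
  qed
  then have "stop_rule (Suc n) m s (case_nat z \<omega>) = Min (Suc ` ({k. k < n \<and> ?P' k} \<union> {n}))"
    unfolding stop_rule_def by (rule arg_cong)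
  also have "\<dots> = Suc (Min ({k. k < n \<and> ?P' k} \<union> {n}))"
    by (rule mono_Min_commute[symmetric]) (auto simp: mono_def)
  finally show ?thesis unfolding stop_rule_def .
qed

lemma measurable_filter_from:
  assumes m: "m \<in> BX M \<rightarrow>\<^sub>M prob_algebra (BY M)" and "j \<le> k"
  shows "(\<lambda>\<omega>. filter_from m j (\<lambda>i. fst (\<omega> i))) \<in> obs_filtration M k \<rightarrow>\<^sub>M prob_algebra (BY M)"
  using assms(2)
proof (induction j)
  case 0
  show ?case
    using measurable_compose[OF measurable_obs_coordinate[of 0 k] m] by simp
next
  case (Suc j)
  then show ?case
    unfolding filter_from.simps
    by (intro measurable_update measurable_obs_coordinate) simp_all
qed

text \<open>
  The decision at time \<open>j\<close> compares functions of the observation, the filter and the accumulated cost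
  at time \<open>j\<close>, and involves only the value functions with horizon less than \<open>n\<close>.
\<close>

lemma stop_rule_stopping_time:
  assumes V: "\<And>i. i < n \<Longrightarrow> V_measurable i" and m: "m \<in> BX M \<rightarrow>\<^sub>M prob_algebra (BY M)"
  shows "stop_rule n m s \<in> stopping_times M n"
proof (rule stopping_timesI)
  show "stop_rule n m s \<omega> \<le> n" for \<omega>
    unfolding stop_rule_def by (intro Min_le) auto
  fix k
  let ?E = "\<lambda>j. {\<omega> \<in> space (obs_filtration M k). f_star M (n - j) (fst (\<omega> j))
      (filter_from m j (\<lambda>i. fst (\<omega> i))) (s + (\<Sum>i<j. cost M (fst (\<omega> i)))) = 1}"
  have E: "?E j \<in> sets (obs_filtration M k)" if "j < n" "j \<le> k" for j
  proof -
    have n: "n - j = Suc (n - Suc j)" using that by simp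
    show ?thesis
      unfolding n
    proof (rule measurable_stop_event)
      show "V_measurable (n - Suc j)" using that by (intro V) simp
      show "(\<lambda>\<omega>. s + (\<Sum>i<j. cost M (fst (\<omega> i)))) \<in> borel_measurable (obs_filtration M k)"
        using that
        by (intro borel_measurable_add borel_measurable_sum measurable_const
              measurable_compose[OF measurable_obs_coordinate measurable_cost]) simp_all
    qed (use that m in \<open>auto intro: measurable_obs_coordinate measurable_filter_from\<close>)
  qed
  \<comment> \<open>The index \<open>n\<close> always belongs to the set whose minimum is taken, so the rule has stopped by any time \<open>k \<ge> n\<close>.\<close>
  have "{\<omega> \<in> space paths. stop_rule n m s \<omega> \<le> k} =
      (if n \<le> k then space (obs_filtration M k) else (\<Union>j\<in>{j. j < n \<and> j \<le> k}. ?E j))"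
    unfolding stop_rule_def space_obs_filtration by (subst Min_le_iff) auto
  also have "\<dots> \<in> sets (obs_filtration M k)"
    using E by (auto intro!: sets.finite_UN)
  finally show "{\<omega> \<in> space paths. stop_rule n m s \<omega> \<le> k} \<in> sets (obs_filtration M k)" .
qed

text \<open>
  All paths started with observation \<open>x\<close> agree in what is observed at time \<open>0\<close>.
\<close>

lemma stopping_time_dichotomy:
  assumes \<tau>: "\<tau> \<in> stopping_times M n" and x: "x \<in> spaceX M"
  obtains (stop) "\<And>y \<omega>. y \<in> spaceY M \<Longrightarrow> \<omega> \<in> space paths \<Longrightarrow> \<tau> (case_nat (x, y) \<omega>) = 0"
    | (continue) "\<And>y \<omega>. y \<in> spaceY M \<Longrightarrow> \<omega> \<in> space paths \<Longrightarrow> \<tau> (case_nat (x, y) \<omega>) \<noteq> 0"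
proof -
  have "\<tau> (case_nat (x, y') \<omega>') = 0"
    if "y \<in> spaceY M" "\<omega> \<in> space paths" "y' \<in> spaceY M" "\<omega>' \<in> space paths"
      "\<tau> (case_nat (x, y) \<omega>) = 0" for y \<omega> y' \<omega>'
    using stopping_times_cong[OF \<tau>, of "case_nat (x, y) \<omega>" "case_nat (x, y') \<omega>'"] that x
    by (simp add: case_nat_in_paths space_states)
  then show thesis using stop continue by blast
qed

end

context integrable_stopping_problem
begin

text \<open>
  The order of the quantifiers is the point: one stopping time serves all first observations \<open>x\<close>,
  although the belief \<open>m x\<close> varies with \<open>x\<close>.
\<close>

definition attained :: "nat \<Rightarrow> bool" where
  "attained n \<longleftrightarrow> (\<forall>m\<in>BX M \<rightarrow>\<^sub>M prob_algebra (BY M). \<forall>s.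
     \<exists>\<tau>\<in>stopping_times M n. \<forall>x\<in>spaceX M. policy_value \<tau> x (m x) s = V M n x (m x) s)"

lemma policy_value_le_V:
  "\<tau> \<in> stopping_times M n \<Longrightarrow> policy_value \<tau> x \<mu> s \<le> V M n x \<mu> s"
  unfolding V_eq_SUP by (rule SUP_upper)

lemma V_Suc_le:
  assumes x: "x \<in> spaceX M" and \<mu>: "\<mu> \<in> space (prob_algebra (BY M))" and n: "Suc n \<le> N"
  shows "V M (Suc n) x \<mu> s \<le>
    max (ereal (util M (gain M x + s))) (continuation M (Suc n) x \<mu> s)"
  unfolding V_eq_SUP
proof (rule SUP_least)
  fix \<tau> assume \<tau>: "\<tau> \<in> stopping_times M (Suc n)"
  show "policy_value \<tau> x \<mu> s \<le> max (ereal (util M (gain M x + s))) (continuation M (Suc n) x \<mu> s)"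
    using \<tau> x
  proof (cases rule: stopping_time_dichotomy)
    case stop
    then show ?thesis using policy_value_stop[OF \<tau> x \<mu>] by simp
  next
    case continue
    interpret \<mu>: prob_space \<mu> using \<mu> by (rule prob_algebra_BY)
    obtain y0 where y0: "y0 \<in> spaceY M"
      using \<mu>.not_empty by (auto simp: prob_algebra_BY(3)[OF \<mu>])
    then have z0: "(x, y0) \<in> space states" using x by (simp add: space_states)
    \<comment> \<open>Any hidden state will do, since \<open>\<tau>\<close> sees only the observation \<open>x\<close>.\<close>
    define \<tau>' where "\<tau>' \<omega> = \<tau> (case_nat (x, y0) \<omega>) - 1" for \<omega>
    have \<tau>': "\<tau>' \<in> stopping_times M n"
      unfolding \<tau>'_def by (rule residual_stopping_time[OF \<tau> z0])
    have shift: "\<tau> (case_nat (x, y) \<omega>) = Suc (\<tau>' \<omega>)"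
      if y: "y \<in> spaceY M" and \<omega>: "\<omega> \<in> space paths" for y \<omega>
    proof -
      have "\<tau> (case_nat (x, y) \<omega>) = \<tau> (case_nat (x, y0) \<omega>)"
        using x y \<omega> z0
        by (intro stopping_times_cong[OF \<tau>] case_nat_in_paths) (auto simp: space_states split: nat.split)
      then show ?thesis using continue[OF y0 \<omega>] by (simp add: \<tau>'_def)
    qed
    have "policy_value \<tau> x \<mu> s = ext_integral (kernel_X M x \<mu>)
        (\<lambda>x'. policy_value \<tau>' x' (update M x x' \<mu>) (s + cost M x))"
      using n by (intro policy_value_continue[where \<tau> = \<tau> and \<tau>' = \<tau>', OF x \<mu> _ _ shift] stopping_times_mono[OF _ \<tau>]
          stopping_times_mono[OF _ \<tau>']) simp_all
    also have "\<dots> \<le> continuation M (Suc n) x \<mu> s"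
      unfolding continuation_def diff_Suc_1
      by (intro ext_integral_mono policy_value_le_V \<tau>')
    finally show ?thesis by (simp add: le_max_iff_disj)
  qed
qed

text \<open>
  A stopping time that is optimal after the first step for all next observations at once, delayed by
  one step, has the continuation value as its value.
\<close>

lemma continuation_le_V:
  assumes x: "x \<in> spaceX M" and \<mu>: "\<mu> \<in> space (prob_algebra (BY M))" and n: "Suc n \<le> N"
    and att: "attained n"
  shows "continuation M (Suc n) x \<mu> s \<le> V M (Suc n) x \<mu> s"
proof -
  have "(\<lambda>x'. update M x x' \<mu>) \<in> BX M \<rightarrow>\<^sub>M prob_algebra (BY M)"
    by (rule measurable_update) (simp_all add: x \<mu> space_BX)
  then obtain \<tau> where \<tau>: "\<tau> \<in> stopping_times M n"
    and opt: "\<And>x'. x' \<in> spaceX M \<Longrightarrow> policy_value \<tau> x' (update M x x' \<mu>) (s + cost M x) =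
      V M n x' (update M x x' \<mu>) (s + cost M x)"
    using att[unfolded attained_def, rule_format, of _ "s + cost M x"] by meson
  let ?\<tau> = "\<lambda>\<omega>. Suc (\<tau> (\<lambda>k. \<omega> (Suc k)))"
  have \<tau>': "?\<tau> \<in> stopping_times M (Suc n)" by (rule delayed_stopping_time[OF \<tau>])
  have "continuation M (Suc n) x \<mu> s = ext_integral (kernel_X M x \<mu>)
      (\<lambda>x'. policy_value \<tau> x' (update M x x' \<mu>) (s + cost M x))"
    unfolding continuation_def diff_Suc_1
    by (intro ext_integral_cong opt[symmetric]) (simp add: space_kernel_X)
  also have "\<dots> = policy_value ?\<tau> x \<mu> s"
    using n by (intro policy_value_continue[symmetric] x \<mu> stopping_times_mono[OF _ \<tau>']
        stopping_times_mono[OF _ \<tau>]) simp_all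
  also have "\<dots> \<le> V M (Suc n) x \<mu> s" by (rule policy_value_le_V[OF \<tau>'])
  finally show ?thesis .
qed

lemma V_Suc:
  assumes x: "x \<in> spaceX M" and \<mu>: "\<mu> \<in> space (prob_algebra (BY M))" and n: "Suc n \<le> N"
    and att: "attained n"
  shows "V M (Suc n) x \<mu> s =
    max (ereal (util M (gain M x + s))) (continuation M (Suc n) x \<mu> s)"
proof (rule antisym)
  show "V M (Suc n) x \<mu> s \<le> max (ereal (util M (gain M x + s))) (continuation M (Suc n) x \<mu> s)"
    by (rule V_Suc_le[OF x \<mu> n])
  have "policy_value (\<lambda>_. 0) x \<mu> s = ereal (util M (gain M x + s))"
    by (rule policy_value_stop[OF zero_stopping_time x \<mu>]) simp
  then have "ereal (util M (gain M x + s)) \<le> V M (Suc n) x \<mu> s"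
    using policy_value_le_V[OF zero_stopping_time, of x \<mu> s "Suc n"] by simp
  with continuation_le_V[OF assms]
  show "max (ereal (util M (gain M x + s))) (continuation M (Suc n) x \<mu> s) \<le> V M (Suc n) x \<mu> s"
    by simp
qed

lemma stop_rule_Suc_optimal:
  assumes V: "\<And>i. i \<le> n \<Longrightarrow> V_measurable i" and n: "Suc n \<le> N" and att: "attained n"
    and opt: "\<And>m s x. m \<in> BX M \<rightarrow>\<^sub>M prob_algebra (BY M) \<Longrightarrow> x \<in> spaceX M \<Longrightarrow>
      policy_value (stop_rule n m s) x (m x) s = V M n x (m x) s"
    and m: "m \<in> BX M \<rightarrow>\<^sub>M prob_algebra (BY M)" and x: "x \<in> spaceX M"
  shows "policy_value (stop_rule (Suc n) m s) x (m x) s = V M (Suc n) x (m x) s"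
proof -
  have \<tau>: "stop_rule (Suc n) m s \<in> stopping_times M (Suc n)"
    using V by (intro stop_rule_stopping_time m) simp
  have \<mu>: "m x \<in> space (prob_algebra (BY M))"
    using measurable_space[OF m] x by (simp add: space_BX)
  show ?thesis
  proof (cases "f_star M (Suc n) x (m x) s = 1")
    case True
    then have "policy_value (stop_rule (Suc n) m s) x (m x) s = ereal (util M (gain M x + s))"
      by (intro policy_value_stop[OF \<tau> x \<mu>] stop_rule_stop) simp
    moreover have "V M (Suc n) x (m x) s = ereal (util M (gain M x + s))"
      using True V_Suc[OF x \<mu> n att, of s] unfolding f_star_eq_1_iff by (simp add: max_def)
    ultimately show ?thesis by simp
  next
    case False
    let ?m = "\<lambda>x'. update M x x' (m x)" and ?s = "s + cost M x"
    have m': "?m \<in> BX M \<rightarrow>\<^sub>M prob_algebra (BY M)"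
      by (rule measurable_update) (simp_all add: x \<mu> space_BX)
    have \<tau>': "stop_rule n ?m ?s \<in> stopping_times M n"
      using V by (intro stop_rule_stopping_time m') simp
    have "policy_value (stop_rule (Suc n) m s) x (m x) s = ext_integral (kernel_X M x (m x))
        (\<lambda>x'. policy_value (stop_rule n ?m ?s) x' (?m x') ?s)"
      using False n stop_rule_continue[of n "(x, _)" m s]
      by (intro policy_value_continue[OF x \<mu>] stopping_times_mono[OF _ \<tau>] stopping_times_mono[OF _ \<tau>'])
         simp_all
    also have "\<dots> = continuation M (Suc n) x (m x) s"
      unfolding continuation_def diff_Suc_1
      by (intro ext_integral_cong opt[OF m']) (simp add: space_kernel_X)
    also have "\<dots> = V M (Suc n) x (m x) s"
      using False V_Suc[OF x \<mu> n att, of s] unfolding f_star_eq_1_iff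
      by (simp add: not_le max_absorb2 less_imp_le)
    finally show ?thesis .
  qed
qed

lemma V_measurable_0: "V_measurable 0"
  unfolding V_measurable_def
proof (rule measurable_cong[THEN iffD1])
  show "(\<lambda>p. ereal (util M (gain M (fst p) + snd (snd p))))
      \<in> borel_measurable (BX M \<Otimes>\<^sub>M (prob_algebra (BY M) \<Otimes>\<^sub>M borel))"
    by (rule measurable_reward) (rule measurable_fst measurable_compose[OF measurable_snd measurable_snd])+
qed (auto simp: V_0 space_pair_measure space_BX)

lemma V_measurable_Suc:
  assumes V: "V_measurable n" and n: "Suc n \<le> N" and att: "attained n"
  shows "V_measurable (Suc n)"
  unfolding V_measurable_def
proof (rule measurable_cong[THEN iffD1])
  let ?A = "BX M \<Otimes>\<^sub>M (prob_algebra (BY M) \<Otimes>\<^sub>M borel)"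
  show "(\<lambda>p. max (ereal (util M (gain M (fst p) + snd (snd p))))
      (continuation M (Suc n) (fst p) (fst (snd p)) (snd (snd p)))) \<in> borel_measurable ?A"
    by (intro borel_measurable_max measurable_reward measurable_continuation[OF V] measurable_fst
        measurable_compose[OF measurable_snd measurable_snd]
        measurable_compose[OF measurable_snd measurable_fst])
qed (auto simp: V_Suc n att space_pair_measure space_BX)

text \<open>
  The two assertions are proved together: the rule with horizon \<open>n + 1\<close> is a stopping time because the
  value functions up to \<open>n\<close> are measurable, and \<open>V\<^sub>n\<^sub>+\<^sub>1\<close> is measurable because it satisfies the
  recursion, which in turn rests on the rule with horizon \<open>n\<close> attaining \<open>V\<^sub>n\<close>.
\<close>

lemma stop_rule_optimal:
  assumes "n \<le> N"
  shows "(\<forall>i\<le>n. V_measurable i) \<and> (\<forall>m\<in>BX M \<rightarrow>\<^sub>M prob_algebra (BY M). \<forall>s. \<forall>x\<in>spaceX M.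
    policy_value (stop_rule n m s) x (m x) s = V M n x (m x) s)"
  using assms
proof (induction n)
  case 0
  have "policy_value (stop_rule 0 m s) x (m x) s = V M 0 x (m x) s"
    if m: "m \<in> BX M \<rightarrow>\<^sub>M prob_algebra (BY M)" and x: "x \<in> spaceX M" for m s x
  proof -
    have \<mu>: "m x \<in> space (prob_algebra (BY M))"
      using measurable_space[OF m] x by (simp add: space_BX)
    have "stop_rule 0 m s \<in> stopping_times M 0"
      by (intro stop_rule_stopping_time m) simp
    from policy_value_stop[OF this x \<mu>] show ?thesis
      by (simp add: V_0[OF x \<mu>] stop_rule_def)
  qed
  then show ?case using V_measurable_0 by simp
next
  case (Suc n)
  then have V: "V_measurable i" if "i \<le> n" for i using that by simp
  have opt: "policy_value (stop_rule n m s) x (m x) s = V M n x (m x) s"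
    if "m \<in> BX M \<rightarrow>\<^sub>M prob_algebra (BY M)" "x \<in> spaceX M" for m s x
    using Suc that by simp
  have "stop_rule n m s \<in> stopping_times M n" if "m \<in> BX M \<rightarrow>\<^sub>M prob_algebra (BY M)" for m s
    using V by (intro stop_rule_stopping_time that) simp
  with opt have att: "attained n"
    unfolding attained_def by blast
  have "V_measurable (Suc n)"
    using V Suc.prems att by (intro V_measurable_Suc) simp_all
  then have "\<forall>i\<le>Suc n. V_measurable i"
    using V by (simp add: le_Suc_eq)
  moreover have "policy_value (stop_rule (Suc n) m s) x (m x) s = V M (Suc n) x (m x) s"
    if "m \<in> BX M \<rightarrow>\<^sub>M prob_algebra (BY M)" "x \<in> spaceX M" for m s x
    by (rule stop_rule_Suc_optimal[OF V Suc.prems att opt that])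
  ultimately show ?case by blast
qed

lemma stop_rule_admissible:
  assumes "n \<le> N" and "m \<in> BX M \<rightarrow>\<^sub>M prob_algebra (BY M)"
  shows "stop_rule n m s \<in> stopping_times M n"
  using stop_rule_optimal[OF assms(1)] assms(2) by (intro stop_rule_stopping_time) simp_all

lemma bellman_equation:
  assumes x: "x \<in> spaceX M" and \<mu>: "\<mu> \<in> space (prob_algebra (BY M))" and n: "Suc n \<le> N"
  shows "V M (Suc n) x \<mu> s = max (ereal (util M (gain M x + s))) (continuation M (Suc n) x \<mu> s)"
proof (rule V_Suc[OF x \<mu> n])
  have "n \<le> N" using n by simp
  then show "attained n"
    using stop_rule_optimal stop_rule_admissible unfolding attained_def by meson
qed

lemma J_eq_V:
  assumes x: "x \<in> spaceX M"
  shows "J M N x = V M N x (init M) 0"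
  unfolding J_def V_eq_SUP by (intro SUP_cong refl objective_eq[OF x])

lemma tau_star_stopping_time: "tau_star M N \<in> stopping_times M N"
  unfolding tau_star_eq using init_prob by (intro stop_rule_admissible) simp_all

lemma tau_star_optimal:
  assumes x: "x \<in> spaceX M"
  shows "objective M x (tau_star M N) = J M N x"
proof -
  have "(\<lambda>_. init M) \<in> BX M \<rightarrow>\<^sub>M prob_algebra (BY M)"
    using init_prob by simp
  then have "policy_value (stop_rule N (\<lambda>_. init M) 0) x (init M) 0 = V M N x (init M) 0"
    using stop_rule_optimal[of N] x by blast
  then show ?thesis
    unfolding objective_eq[OF x tau_star_stopping_time] J_eq_V[OF x] by (simp add: tau_star_eq)
qed

end

theorem theorem3p1:
  fixes M :: "('x::polish_space, 'y::polish_space) stopping_model" and N :: nat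
  assumes "stopping_problem M"
    and "N \<ge> 1"
    and "\<forall>x\<in>spaceX M. (SUP \<tau>\<in>stopping_times M N. SUP y\<in>spaceY M.
           \<integral>\<^sup>+ \<omega>. ennreal ((\<Sum>k<\<tau> \<omega>. max (cost M (fst (\<omega> k))) 0)
                            + max (gain M (fst (\<omega> (\<tau> \<omega>)))) 0) \<partial>law M x y) < \<infinity>"
  shows
    "((\<forall>x\<in>spaceX M. \<forall>\<mu>\<in>space (prob_algebra (BY M)). \<forall>s.
         V M 0 x \<mu> s = ereal (util M (gain M x + s)))
      \<and> (\<forall>n\<in>{1..N}. \<forall>x\<in>spaceX M. \<forall>\<mu>\<in>space (prob_algebra (BY M)). \<forall>s.
           V M n x \<mu> s =
             max (ereal (util M (gain M x + s)))
                 (ext_integral (kernel_X M x \<mu>)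
                    (\<lambda>x'. V M (n - 1) x' (update M x x' \<mu>) (s + cost M x))))
      \<and> (\<forall>x\<in>spaceX M. J M N x = V M N x (init M) 0))
     \<and> (\<forall>x\<in>spaceX M.
           tau_star M N \<in> stopping_times M N \<and> objective M x (tau_star M N) = J M N x)"
proof -
  interpret integrable_stopping_problem M N
    by (intro integrable_stopping_problem.intro integrable_stopping_problem_axioms.intro assms(1,3))
  have "V M n x \<mu> s = max (ereal (util M (gain M x + s)))
      (ext_integral (kernel_X M x \<mu>) (\<lambda>x'. V M (n - 1) x' (update M x x' \<mu>) (s + cost M x)))"
    if "n \<in> {1..N}" "x \<in> spaceX M" "\<mu> \<in> space (prob_algebra (BY M))" for n x \<mu> s
    using bellman_equation[of x \<mu> "n - 1" s] that by (simp add: continuation_def)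
  then show ?thesis
    using V_0 J_eq_V tau_star_stopping_time tau_star_optimal by simp
qed

end
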